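(* Let $HG$ be the Heawood graph and let $f:HG\to\mathbb{R}^{2}$ be a plane generic immersion. Then \[ \sum_{\gamma\in\Gamma_{6}(HG)}c(f(\gamma))\equiv\sum_{\gamma\in\Gamma_{8}(HG)}c(f(\gamma))\equiv\sum_{\gamma\in\Gamma_{10}(HG)}c(f(\gamma))\equiv 1\pmod 2, \] \[ \sum_{\gamma\in\Gamma_{12}(HG)}c(f(\gamma))\equiv 0\pmod 4, \] and \[ \sum_{\gamma\in\Gamma_{14}(HG)}c(f(\gamma))\equiv 0\pmod 2, \] where $\Gamma_k(HG)$ is the set of all $k$-cycles of $HG$.
   Context: The Heawood graph $HG$ has vertices $u_i,v_i$ ($i\in\mathbb{Z}/7\mathbb{Z}$) and the $21$ edges $u_iv_i$, $u_iv_{i-1}$, $v_iu_{i-2}$. A finite graph $G$ is regarded as a topological space in the usual way. A $k$-cycle of $G$ is a subgraph with $k$ edges that is homeomorphic to a circle (cycles are unoriented subgraphs). A plane generic immersion of $G$ is an immersion $f:G\to\mathbb{R}^2$ (a continuous locally injective, piecewise smooth map) whose multiple points are only finitely many transversal double points between edges, i.e. between interior points of edges (possibly of the same edge); these double points are called crossings. For a subgraph $H$ of $G$, $c(f(H))$ denotes the number of crossings of the restriction $f|_H$. *)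

theory Defs
  imports "HOL-Analysis.Analysis" "HOL-Number_Theory.Cong"
begin

text \<open>
  Finite simple graphs are pairs (vertices, edges) over a finite type, an edge being the
  two-element set of its endpoints.
\<close>

type_synonym 'v graph = "'v set \<times> 'v set set"

definition subgraph :: "'v graph \<Rightarrow> 'v graph \<Rightarrow> bool" where
  "subgraph H G \<longleftrightarrow> fst H \<subseteq> fst G \<and> snd H \<subseteq> snd G \<and> \<Union>(snd H) \<subseteq> fst H"

text \<open>
  The underlying space of a graph, as a one-dimensional simplicial complex: vertex \<open>v\<close> is the
  unit vector \<open>axis v 1\<close> and the edge with endpoints \<open>a\<close>, \<open>b\<close> is the segment joining the
  corresponding unit vectors. Different edges meet only in common endpoints, and the space of
  a subgraph is a subset of the space of the graph.
\<close>

definition realization :: "'v::finite graph \<Rightarrow> (real ^ 'v) set" where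
  "realization G =
     (\<lambda>v. axis v 1) ` fst G \<union> (\<Union>e\<in>snd G. convex hull ((\<lambda>v. axis v 1) ` e))"

definition edge_path :: "'v::finite \<Rightarrow> 'v \<Rightarrow> real \<Rightarrow> real ^ 'v" where
  "edge_path a b = linepath (axis a 1) (axis b 1)"

definition cycles :: "nat \<Rightarrow> 'v::finite graph \<Rightarrow> 'v graph set" where
  "cycles k G =
     {H. subgraph H G \<and> card (snd H) = k \<and>
         realization H homeomorphic (sphere 0 1 :: (real ^ 2) set)}"

definition locally_inj_on :: "('a::topological_space \<Rightarrow> 'b) \<Rightarrow> 'a set \<Rightarrow> bool" where
  "locally_inj_on f X \<longleftrightarrow> (\<forall>x\<in>X. \<exists>U. open U \<and> x \<in> U \<and> inj_on f (U \<inter> X))"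

text \<open>
  Smooth (that is, infinitely differentiable) on a compact interval, with one-sided
  derivatives at the endpoints; \<open>D n\<close> is the derivative of order \<open>n\<close>.
\<close>

definition smooth_on_interval :: "(real \<Rightarrow> 'a::real_normed_vector) \<Rightarrow> real \<Rightarrow> real \<Rightarrow> bool" where
  "smooth_on_interval g a b \<longleftrightarrow>
     (\<exists>D. D (0::nat) = g \<and>
          (\<forall>n. \<forall>t\<in>{a..b}. (D n has_vector_derivative D (Suc n) t) (at t within {a..b})))"

definition piecewise_smooth_path :: "(real \<Rightarrow> 'a::real_normed_vector) \<Rightarrow> bool" where
  "piecewise_smooth_path g \<longleftrightarrow>
     (\<exists>S. finite S \<and>
          (\<forall>a b. 0 \<le> a \<and> a < b \<and> b \<le> 1 \<and> {a<..<b} \<inter> S = {} \<longrightarrow> smooth_on_interval g a b))"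

definition plane_immersion :: "'v::finite graph \<Rightarrow> (real ^ 'v \<Rightarrow> real ^ 2) \<Rightarrow> bool" where
  "plane_immersion G f \<longleftrightarrow>
     continuous_on (realization G) f \<and>
     locally_inj_on f (realization G) \<and>
     (\<forall>a b. {a, b} \<in> snd G \<longrightarrow> piecewise_smooth_path (f \<circ> edge_path a b))"

definition multiple_points :: "('a \<Rightarrow> 'b) \<Rightarrow> 'a set \<Rightarrow> 'b set" where
  "multiple_points f X = {p. \<exists>x\<in>X. \<exists>y\<in>X. x \<noteq> y \<and> f x = p \<and> f y = p}"

text \<open>
  \<open>x\<close> and \<open>y\<close> are interior points of (possibly equal) edges, and the two branches of \<open>f\<close>
  through them have tangent vectors there that together span the plane. In particular \<open>f\<close> has
  no corner at \<open>x\<close> or \<open>y\<close>.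
\<close>

definition transversal_at ::
  "'v::finite graph \<Rightarrow> (real ^ 'v \<Rightarrow> real ^ 2) \<Rightarrow> real ^ 'v \<Rightarrow> real ^ 'v \<Rightarrow> bool" where
  "transversal_at G f x y \<longleftrightarrow>
     (\<exists>a b c d s t D D'.
        {a, b} \<in> snd G \<and> 0 < s \<and> s < 1 \<and> x = edge_path a b s \<and>
        {c, d} \<in> snd G \<and> 0 < t \<and> t < 1 \<and> y = edge_path c d t \<and>
        ((f \<circ> edge_path a b) has_vector_derivative D) (at s) \<and>
        ((f \<circ> edge_path c d) has_vector_derivative D') (at t) \<and>
        span {D, D'} = UNIV)"

definition plane_generic_immersion :: "'v::finite graph \<Rightarrow> (real ^ 'v \<Rightarrow> real ^ 2) \<Rightarrow> bool" where
  "plane_generic_immersion G f \<longleftrightarrow>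
     plane_immersion G f \<and>
     finite (multiple_points f (realization G)) \<and>
     (\<forall>p\<in>multiple_points f (realization G).
        \<exists>x y. x \<noteq> y \<and> {z \<in> realization G. f z = p} = {x, y} \<and> transversal_at G f x y)"

definition crossing_number :: "(real ^ 'v::finite \<Rightarrow> real ^ 2) \<Rightarrow> 'v graph \<Rightarrow> nat" where
  "crossing_number f H = card (multiple_points f (realization H))"

text \<open>
  The vertices \<open>u\<^sub>i\<close> and \<open>v\<^sub>i\<close> are \<open>Inl i\<close> and \<open>Inr i\<close>; the numeral type \<open>7\<close> is the ring of
  integers modulo 7.
\<close>

definition heawood_graph :: "(7 + 7) graph" where
  "heawood_graph =
     (UNIV,
      (\<Union>i. {{Inl i, Inr i}, {Inl i, Inr (i - 1)}, {Inr i, Inl (i - 2)}}))"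

end

theory Submission
  imports Defs "HOL-Complex_Analysis.Complex_Analysis"
begin

text \<open>
  Counting a crossing in every cycle that passes through it turns the sum over all \<open>k\<close>-cycles into
  a sum over the crossings of the number of \<open>k\<close>-cycles containing both edges involved. For \<open>k = 12\<close>
  these numbers are multiples of 4 and for \<open>k = 14\<close> they are even; for \<open>k = 6, 8, 10\<close> they are odd
  precisely for pairs of edges at distance 2. So it remains to see that the crossings between edges
  at distance 2 are odd in number.

  For disjoint edges \<open>e\<close>, \<open>e'\<close> the number of crossings has the parity of the winding number around 0 of
  \<open>(s, t) \<mapsto> f (e s) - f (e' t)\<close> along the boundary of the unit square. Each side of the square contributes
  the change of direction from a vertex \<open>v\<close> to a point running along an edge. After fixing an argument
  for the direction between any two vertices, this change is determined up to an integer \<open>n v e\<close>.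
  The 84 pairs at distance 2 form a mod 2 cycle: for each \<open>v\<close> and \<open>e\<close>, either no or exactly two edges
  at \<open>v\<close> have distance 2 from \<open>e\<close>. Hence the integers \<open>n v e\<close> cancel modulo 2, and what remains is a sum
  independent of \<open>f\<close>, which is odd. This is the mod 2 van Kampen obstruction.
\<close>

section \<open>Winding numbers of maps along rectangles\<close>

text \<open>Winding numbers only control pairs of disjoint edges: for adjacent edges the difference
  map vanishes at a corner of the square, and for an edge paired with itself along the whole
  diagonal. Self-crossings and crossings of adjacent edges are therefore never analysed. They drop
  out because the number of cycles through such a pair is even, and for \<open>k = 12\<close> a
  multiple of 4. Distance 2 is in turn a class for which the cycle condition holds: the Heawood
  graph is the incidence graph of the Fano plane, and the edges at distance 2 from a given edge form
  an 8-cycle.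

  Neither a reference drawing nor a deformation of \<open>f\<close> is used. The constant that
  remains comes from comparing arguments of opposite directions; modulo 2 it is the number of
  crossing pairs of chords at distance 2 when the 14 vertices lie on a convex curve.

  A separate obstacle is that cycles are defined topologically, by a homeomorphism with the circle,
  while cycle counts are evaluated on vertex lists. The bridge is that a circle stays connected when
  a point is removed.\<close>

definition turn :: "(complex \<Rightarrow> complex) \<Rightarrow> complex \<Rightarrow> complex \<Rightarrow> complex" where
  "turn G z w = winding_number (G \<circ> linepath z w) 0"

definition rect_turn :: "(complex \<Rightarrow> complex) \<Rightarrow> complex \<Rightarrow> complex \<Rightarrow> complex" where
  "rect_turn G a b =
     turn G a (Complex (Re b) (Im a)) + turn G (Complex (Re b) (Im a)) b
     + turn G b (Complex (Re a) (Im b)) + turn G (Complex (Re a) (Im b)) a"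

text \<open>For an open path \<open>winding_number\<close> is the change of a continuous logarithm
  divided by \<open>2 * pi * \<i>\<close>; it need be neither an integer nor real. All additivity of
  \<open>turn\<close> comes from this formula.\<close>

lemma turn_log:
  assumes "convex S" "continuous_on S g" "\<And>z. z \<in> S \<Longrightarrow> G z = exp (g z)" "z \<in> S" "w \<in> S"
  shows "turn G z w = (g w - g z) / (2 * of_real pi * \<i>)"
proof -
  have seg: "linepath z w t \<in> S" if "t \<in> {0..1}" for t
    using that assms(1,4,5) by (metis closed_segment_subset linepath_in_path path_image_linepath subsetD)
  have "turn G z w = winding_number (exp \<circ> (g \<circ> linepath z w)) 0"
    unfolding turn_def
    by (rule winding_number_cong) (use seg assms(3) in auto)
  also have "\<dots> = (g w - g z) / (2 * of_real pi * \<i>)"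
  proof -
    have "path (g \<circ> linepath z w)"
      unfolding path_def
      by (rule continuous_on_compose)
        (auto intro!: continuous_on_subset[OF assms(2)] continuous_intros seg)
    then show ?thesis
      by (subst winding_number_compose_exp)
        (auto simp: pathstart_def pathfinish_def linepath_def)
  qed
  finally show ?thesis .
qed

lemma convex_log:
  fixes G :: "complex \<Rightarrow> complex"
  assumes "convex S" "continuous_on S G" "\<And>z. z \<in> S \<Longrightarrow> G z \<noteq> 0"
  obtains g where "continuous_on S g" "\<And>z. z \<in> S \<Longrightarrow> G z = exp (g z)"
  using continuous_logarithm_on_contractible[OF assms(2) convex_imp_contractible[OF assms(1)] assms(3)]
  by metis

lemma turn_split:
  assumes "continuous_on (closed_segment z w) G" "\<And>x. x \<in> closed_segment z w \<Longrightarrow> G x \<noteq> 0"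
    and "c \<in> closed_segment z w"
  shows "turn G z w = turn G z c + turn G c w"
proof -
  obtain g where "continuous_on (closed_segment z w) g"
      "\<And>x. x \<in> closed_segment z w \<Longrightarrow> G x = exp (g x)"
    using convex_log[OF convex_closed_segment assms(1,2)] by metis
  then show ?thesis
    using assms(3) by (simp add: turn_log[OF convex_closed_segment] field_simps)
qed

lemma turn_reverse:
  assumes "continuous_on (closed_segment z w) G" "\<And>x. x \<in> closed_segment z w \<Longrightarrow> G x \<noteq> 0"
  shows "turn G w z = - turn G z w"
proof -
  obtain g where "continuous_on (closed_segment z w) g"
      "\<And>x. x \<in> closed_segment z w \<Longrightarrow> G x = exp (g x)"
    using convex_log[OF convex_closed_segment assms(1,2)] by metis
  then show ?thesis
    by (simp add: turn_log[OF convex_closed_segment] field_simps)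
qed

text \<open>One logarithm serves the whole rectangle, so its changes along the four sides
  telescope.\<close>

lemma rect_turn_eq_0:
  assumes "Re a \<le> Re b" "Im a \<le> Im b" "continuous_on (cbox a b) G"
    and "\<And>z. z \<in> cbox a b \<Longrightarrow> G z \<noteq> 0"
  shows "rect_turn G a b = 0"
proof -
  obtain g where "continuous_on (cbox a b) g" "\<And>x. x \<in> cbox a b \<Longrightarrow> G x = exp (g x)"
    using convex_log[OF convex_box(1) assms(3,4)] by metis
  note g = this
  have "turn G z w = (g w - g z) / (2 * of_real pi * \<i>)" if "z \<in> cbox a b" "w \<in> cbox a b" for z w
    by (rule turn_log[OF convex_box(1) g that])
  then show ?thesis
    using assms(1,2)
    by (simp add: rect_turn_def in_cbox_complex_iff flip: add_divide_distrib)
qed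

text \<open>Subdivision works side by side, homotopy works with closed loops; this links the two.
  Zeros in the interior are allowed.\<close>

lemma rect_turn_eq_winding_number:
  assumes "Re a \<le> Re b" "Im a \<le> Im b" "continuous_on (cbox a b) G"
    and nz: "\<And>z. z \<in> cbox a b - box a b \<Longrightarrow> G z \<noteq> 0"
  shows "rect_turn G a b = winding_number (G \<circ> rectpath a b) 0"
proof -
  define a2 a4 where "a2 = Complex (Re b) (Im a)" and "a4 = Complex (Re a) (Im b)"
  have sub: "path_image (rectpath a b) = cbox a b - box a b"
    using assms by (simp add: path_image_rectpath_cbox_minus_box)
  have im: "path_image (rectpath a b) = closed_segment a a2 \<union> (closed_segment a2 b \<union> (closed_segment b a4 \<union> closed_segment a4 a))"
    by (simp add: rectpath_def Let_def path_image_join a2_def a4_def)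
  have *: "path (G \<circ> linepath x y) \<and> 0 \<notin> path_image (G \<circ> linepath x y)"
    if "closed_segment x y \<subseteq> path_image (rectpath a b)" for x y
  proof
    show "path (G \<circ> linepath x y)"
      unfolding path_def
      using that sub
      by (intro continuous_on_compose continuous_on_subset[OF assms(3)])
         (auto intro!: continuous_intros simp: linepath_image_01)
    show "0 \<notin> path_image (G \<circ> linepath x y)"
      unfolding path_image_compose using that sub nz by force
  qed
  have p: "path (G \<circ> linepath a a2)" "0 \<notin> path_image (G \<circ> linepath a a2)"
    "path (G \<circ> linepath a2 b)" "0 \<notin> path_image (G \<circ> linepath a2 b)"
    "path (G \<circ> linepath b a4)" "0 \<notin> path_image (G \<circ> linepath b a4)"
    "path (G \<circ> linepath a4 a)" "0 \<notin> path_image (G \<circ> linepath a4 a)"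
    using * im by blast+
  show ?thesis
    unfolding rectpath_def Let_def a2_def[symmetric] a4_def[symmetric] path_compose_join
    using p
    by (simp add: winding_number_join not_in_path_image_join pathstart_compose pathfinish_compose
       rect_turn_def turn_def a2_def a4_def)
qed

lemma in_closed_segment_horizontal:
  "x \<le> y \<Longrightarrow> z \<in> closed_segment (Complex x t) (Complex y t) \<longleftrightarrow> Im z = t \<and> Re z \<in> {x..y}"
  by (auto simp: closed_segment_same_Im closed_segment_eq_real_ivl)

lemma in_closed_segment_vertical:
  "x \<le> y \<Longrightarrow> z \<in> closed_segment (Complex t x) (Complex t y) \<longleftrightarrow> Re z = t \<and> Im z \<in> {x..y}"
  by (auto simp: closed_segment_same_Re closed_segment_eq_real_ivl)

text \<open>With opposite sides oriented alike, a side shared by two rectangles cancels visibly, and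
  in \<open>crossing_parity\<close> the four sides become windings of one path around the ends of
  the other.\<close>

lemma rect_turn_alt:
  assumes "x \<le> x'" "y \<le> y'" 
    and "continuous_on (cbox (Complex x y) (Complex x' y')) G"
    and nz: "\<And>z. z \<in> cbox (Complex x y) (Complex x' y') - box (Complex x y) (Complex x' y') \<Longrightarrow> G z \<noteq> 0"
  shows "rect_turn G (Complex x y) (Complex x' y') =
     turn G (Complex x y) (Complex x' y) + turn G (Complex x' y) (Complex x' y')
     - turn G (Complex x y') (Complex x' y') - turn G (Complex x y) (Complex x y')"
proof -
  have "turn G (Complex x' y') (Complex x y') = - turn G (Complex x y') (Complex x' y')"
       "turn G (Complex x y') (Complex x y) = - turn G (Complex x y) (Complex x y')"
    by (rule turn_reverse, rule continuous_on_subset[OF assms(3)],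
        (use assms(1,2) in \<open>force simp: in_closed_segment_horizontal in_closed_segment_vertical
            in_cbox_complex_iff\<close>),
        rule nz, (use assms(1,2) in \<open>force simp: in_closed_segment_horizontal in_closed_segment_vertical
            in_cbox_complex_iff in_box_complex_iff\<close>))+
  then show ?thesis
    by (simp add: rect_turn_def)
qed

text \<open>The cut enters the two halves with opposite signs. It has to miss the zeros so that
  reversing it negates its turn.\<close>

lemma rect_turn_split_vertical:
  assumes "x \<le> c" "c \<le> x'" "y \<le> y'"
    and cont: "continuous_on (cbox (Complex x y) (Complex x' y')) G"
    and nz: "\<And>z. z \<in> cbox (Complex x y) (Complex x' y') \<Longrightarrow> G z = 0 \<Longrightarrow>
        z \<in> box (Complex x y) (Complex x' y') \<and> Re z \<noteq> c"
  shows "rect_turn G (Complex x y) (Complex x' y') =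
     rect_turn G (Complex x y) (Complex c y') + rect_turn G (Complex c y) (Complex x' y')"
proof -
  have "turn G (Complex x t) (Complex x' t) = 
      turn G (Complex x t) (Complex c t) + turn G (Complex c t) (Complex x' t)" if "t = y \<or> t = y'" for t
    apply (rule turn_split)
    apply (rule continuous_on_subset[OF cont])
    using that assms(1-3) apply (force simp: in_closed_segment_horizontal in_cbox_complex_iff)
    using that assms(1-3) nz 
      apply (fastforce simp: in_closed_segment_horizontal in_cbox_complex_iff in_box_complex_iff)
    using assms(1-3) apply (simp add: in_closed_segment_horizontal)
    done
  note t = this
  have "G z \<noteq> 0" if "z \<in> cbox (Complex x y) (Complex x' y') - box (Complex x y) (Complex x' y') \<or> z \<in> cbox (Complex x y) (Complex x' y') \<and> Re z = c" for z
    using nz that by blast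
  note nz' = this
  have sub: "cbox (Complex x y) (Complex c y') \<subseteq> cbox (Complex x y) (Complex x' y')"
     "cbox (Complex c y) (Complex x' y') \<subseteq> cbox (Complex x y) (Complex x' y')"
    using assms(1-3) by (auto simp: in_cbox_complex_iff)
  have "rect_turn G (Complex x y) (Complex x' y') =
     turn G (Complex x y) (Complex x' y) + turn G (Complex x' y) (Complex x' y')
     - turn G (Complex x y') (Complex x' y') - turn G (Complex x y) (Complex x y')"
    by (rule rect_turn_alt) (use assms(1-3) cont nz' in auto)
  moreover have "rect_turn G (Complex x y) (Complex c y') =
     turn G (Complex x y) (Complex c y) + turn G (Complex c y) (Complex c y')
     - turn G (Complex x y') (Complex c y') - turn G (Complex x y) (Complex x y')"
    by (rule rect_turn_alt[OF assms(1,3) continuous_on_subset[OF cont sub(1)]], rule nz')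
       (use assms(1-3) in \<open>auto simp: in_cbox_complex_iff in_box_complex_iff\<close>)
  moreover have "rect_turn G (Complex c y) (Complex x' y') =
     turn G (Complex c y) (Complex x' y) + turn G (Complex x' y) (Complex x' y')
     - turn G (Complex c y') (Complex x' y') - turn G (Complex c y) (Complex c y')"
    by (rule rect_turn_alt[OF assms(2,3) continuous_on_subset[OF cont sub(2)]], rule nz')
       (use assms(1-3) in \<open>auto simp: in_cbox_complex_iff in_box_complex_iff\<close>)
  ultimately show ?thesis
    by (simp add: t)
qed

lemma rect_turn_split_horizontal:
  assumes "y \<le> c" "c \<le> y'" "x \<le> x'"
    and cont: "continuous_on (cbox (Complex x y) (Complex x' y')) G"
    and nz: "\<And>z. z \<in> cbox (Complex x y) (Complex x' y') \<Longrightarrow> G z = 0 \<Longrightarrow>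
        z \<in> box (Complex x y) (Complex x' y') \<and> Im z \<noteq> c"
  shows "rect_turn G (Complex x y) (Complex x' y') =
     rect_turn G (Complex x y) (Complex x' c) + rect_turn G (Complex x c) (Complex x' y')"
proof -
  have "turn G (Complex t y) (Complex t y') = 
      turn G (Complex t y) (Complex t c) + turn G (Complex t c) (Complex t y')" if "t = x \<or> t = x'" for t
    apply (rule turn_split)
    apply (rule continuous_on_subset[OF cont])
    using that assms(1-3) apply (force simp: in_closed_segment_vertical in_cbox_complex_iff)
    using that assms(1-3) nz 
      apply (fastforce simp: in_closed_segment_vertical in_cbox_complex_iff in_box_complex_iff)
    using assms(1-3) apply (simp add: in_closed_segment_vertical)
    done
  note t = this
  have "G z \<noteq> 0" if "z \<in> cbox (Complex x y) (Complex x' y') - box (Complex x y) (Complex x' y') \<or> z \<in> cbox (Complex x y) (Complex x' y') \<and> Im z = c" for z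
    using nz that by blast
  note nz' = this
  have sub: "cbox (Complex x y) (Complex x' c) \<subseteq> cbox (Complex x y) (Complex x' y')"
     "cbox (Complex x c) (Complex x' y') \<subseteq> cbox (Complex x y) (Complex x' y')"
    using assms(1-3) by (auto simp: in_cbox_complex_iff)
  have "rect_turn G (Complex x y) (Complex x' y') =
     turn G (Complex x y) (Complex x' y) + turn G (Complex x' y) (Complex x' y')
     - turn G (Complex x y') (Complex x' y') - turn G (Complex x y) (Complex x y')"
    by (rule rect_turn_alt) (use assms(1-3) cont nz' in auto)
  moreover have "rect_turn G (Complex x y) (Complex x' c) =
     turn G (Complex x y) (Complex x' y) + turn G (Complex x' y) (Complex x' c)
     - turn G (Complex x c) (Complex x' c) - turn G (Complex x y) (Complex x c)"
    by (rule rect_turn_alt[OF assms(3,1) continuous_on_subset[OF cont sub(1)]], rule nz')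
       (use assms(1-3) in \<open>auto simp: in_cbox_complex_iff in_box_complex_iff\<close>)
  moreover have "rect_turn G (Complex x c) (Complex x' y') =
     turn G (Complex x c) (Complex x' c) + turn G (Complex x' c) (Complex x' y')
     - turn G (Complex x y') (Complex x' y') - turn G (Complex x c) (Complex x y')"
    by (rule rect_turn_alt[OF assms(3,2) continuous_on_subset[OF cont sub(2)]], rule nz')
       (use assms(1-3) in \<open>auto simp: in_cbox_complex_iff in_box_complex_iff\<close>)
  ultimately show ?thesis
    by (simp add: t)
qed

section \<open>Contribution of a single nondegenerate zero\<close>

lemma winding_number_mult_const:
  assumes "path p" "0 \<notin> path_image p" "c \<noteq> 0"
  shows "winding_number (\<lambda>t. c * p t) 0 = winding_number p 0"
proof -
  obtain q where q: "path q" "pathfinish q - pathstart q = 2 * of_real pi * \<i> * winding_number p 0"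
     "\<And>t. t \<in> {0..1} \<Longrightarrow> p t = 0 + exp (q t)"
    using winding_number_as_continuous_log[OF assms(1,2)] by metis
  have "winding_number (\<lambda>t. c * p t) 0 = winding_number (exp \<circ> (\<lambda>t. Ln c + q t)) 0"
    by (rule winding_number_cong) (use q(3) assms(3) in \<open>auto simp: exp_add\<close>)
  also have "\<dots> = winding_number p 0"
    using q(1,2)
    by (subst winding_number_compose_exp)
       (auto simp: path_def pathstart_def pathfinish_def intro!: continuous_intros)
  finally show ?thesis .
qed

text \<open>Division by \<open>L 1\<close> turns the map into \<open>Re z + k * Im z\<close> with
  nonreal \<open>k\<close>. A straight-line homotopy moves \<open>k\<close> to \<open>\<i>\<close>
  or \<open>- \<i>\<close>, whichever lies in the same half-plane, so \<open>L\<close> winds like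
  the identity or like conjugation.\<close>

lemma winding_number_linear_rectpath:
  assumes "linear L" "inj L" "0 \<in> box a b"
  shows "winding_number (L \<circ> rectpath a b) (0::complex) \<in> {1, -1}"
proof -
  have ab: "Re a < 0" "Re b > 0" "Im a < 0" "Im b > 0"
    using assms(3) by (auto simp: in_box_complex_iff)
  have nz: "0 \<notin> path_image (rectpath a b)"
    using ab by (auto simp: path_image_rectpath)
  define k where "k = L \<i> / L 1"
  have L1: "L 1 \<noteq> 0"
    using assms(1,2) by (metis inj_eq linear_0 zero_neq_one)
  have L: "L z = L 1 * (of_real (Re z) + k * of_real (Im z))" for z
  proof -
    have "L z = L (Re z *\<^sub>R 1 + Im z *\<^sub>R \<i>)"
      by (rule arg_cong[where f = L]) (simp add: complex_eq_iff)
    also have "\<dots> = Re z *\<^sub>R L 1 + Im z *\<^sub>R L \<i>"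
      by (simp only: linear_add[OF assms(1)] linear_cmul[OF assms(1)])
    finally show ?thesis
      using L1 by (simp add: k_def field_simps scaleR_conv_of_real)
  qed
  have k: "Im k \<noteq> 0"
  proof
    assume "Im k = 0"
    then have "L \<i> = L (of_real (Re k))"
      by (subst (1 2) L) (simp add: complex_eq_iff)
    then have "\<i> = of_real (Re k)"
      using assms(2) by (simp add: inj_eq)
    then show False
      by (simp add: complex_eq_iff)
  qed
  define M where "M = (\<lambda>z. complex_of_real (Re z) + k * of_real (Im z))"
  define e where "e = sgn (Im k)"
  define N where "N = (\<lambda>z. Complex (Re z) (e * Im z))"
  have cont: "continuous_on S M" "continuous_on S N" for S
    unfolding M_def N_def Complex_eq by (intro continuous_intros)+
  have p: "path (M \<circ> rectpath a b)" "path (N \<circ> rectpath a b)"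
    using cont by (auto intro!: path_continuous_image)
  \<comment> \<open>The imaginary parts of \<open>M z\<close> and \<open>N z\<close> are
    \<open>Im z\<close> times \<open>Im k\<close> and times \<open>e\<close>, two factors of the
    same sign. So a zero on the segment forces \<open>Im z = 0\<close>, and then both ends of the
    segment equal \<open>Re z\<close>.\<close>
  have seg: "0 \<notin> closed_segment (M z) (N z)" if "z \<noteq> 0" for z
  proof
    assume "0 \<in> closed_segment (M z) (N z)"
    then obtain u where u: "0 \<le> u" "u \<le> 1" "0 = (1 - u) *\<^sub>R M z + u *\<^sub>R N z"
      by (auto simp: in_segment)
    have "Im z * ((1 - u) * \<bar>Im k\<bar> + u) * e = 0"
      using arg_cong[OF u(3), of Im]
      by (simp add: M_def N_def e_def sgn_if abs_if algebra_simps split: if_splits)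
    moreover have "(1 - u) * \<bar>Im k\<bar> + u > 0"
      using u k by (cases "u = 1") (auto intro!: add_pos_nonneg mult_pos_pos)
    ultimately have "Im z = 0"
      using k by (auto simp: e_def sgn_if split: if_splits)
    moreover have "Re z = 0"
      using arg_cong[OF u(3), of Re] \<open>Im z = 0\<close>
      by (simp add: M_def N_def algebra_simps)
    ultimately show False
      using that by (simp add: complex_eq_iff)
  qed
  have rnz: "rectpath a b t \<noteq> 0" if "t \<in> {0..1}" for t
    using nz that by (auto simp: path_image_def)
  have "winding_number (L \<circ> rectpath a b) 0 = winding_number (\<lambda>t. L 1 * (M \<circ> rectpath a b) t) 0"
    unfolding comp_def M_def by (rule winding_number_cong) (rule L)
  also have "\<dots> = winding_number (M \<circ> rectpath a b) 0"
  proof (rule winding_number_mult_const)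
    show "0 \<notin> path_image (M \<circ> rectpath a b)"
    proof
      assume "0 \<in> path_image (M \<circ> rectpath a b)"
      then obtain t where "t \<in> {0..1}" "M (rectpath a b t) = 0"
        by (auto simp: path_image_def)
      then show False
        using seg[OF rnz[of t]] by auto
    qed
  qed (use p(1) L1 in \<open>simp_all add: comp_def\<close>)
  also have "\<dots> = winding_number (N \<circ> rectpath a b) 0"
    using p seg rnz by (intro winding_number_loops_linear_eq[symmetric])
       (auto simp: pathstart_compose pathfinish_compose)
  also have "\<dots> \<in> {1,-1}"
  proof -
    have w: "winding_number (rectpath a b) 0 = 1"
      by (rule winding_number_rectpath[OF assms(3)])
    have w': "winding_number (cnj \<circ> rectpath a b) 0 = - 1"
      using winding_number_cnj[of "rectpath a b" 0] nz w by simp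
    have "N = id \<or> N = cnj"
      using k by (auto simp: N_def e_def sgn_if fun_eq_iff complex_eq_iff)
    then show ?thesis
      using w w' by auto
  qed
  finally show ?thesis .
qed

text \<open>Rouche's argument: near the zero the error of the linear approximation is smaller than
  the linear term, so on small rectangles around it both loops wind equally often.\<close>

lemma winding_number_nondegenerate_zero:
  fixes G :: "complex \<Rightarrow> complex"
  assumes G: "(G has_derivative L) (at z)" and "inj L" and "G z = 0"
  shows "\<exists>e>0. \<forall>a b. z \<in> box a b \<and> cbox a b \<subseteq> ball z e \<and> continuous_on (cbox a b) G \<longrightarrow>
    winding_number (G \<circ> rectpath a b) 0 \<in> {1, -1}"
proof -
  have lin: "linear L"
    using G has_derivative_linear by blast
  obtain B where B: "B > 0" "\<And>x. B * norm x \<le> norm (L x)"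
    using linear_inj_bounded_below_pos[OF lin \<open>inj L\<close>] by metis
  \<comment> \<open>Half of the lower bound \<open>B\<close> keeps the error strictly below
    \<open>norm (L (y - z))\<close> for \<open>y \<noteq> z\<close>.\<close>
  obtain e where e: "e > 0" "\<And>y. norm (y - z) < e \<Longrightarrow> norm (G y - G z - L (y - z)) \<le> B / 2 * norm (y - z)"
    using G B(1) unfolding has_derivative_at_alt
    by (metis half_gt_zero)
  show ?thesis
  proof (intro exI conjI allI impI)
    fix a b assume *: "z \<in> box a b \<and> cbox a b \<subseteq> ball z e \<and> continuous_on (cbox a b) G"
    then have ab: "Re a < Re z" "Re z < Re b" "Im a < Im z" "Im z < Im b"
      by (auto simp: in_box_complex_iff)
    have im: "path_image (rectpath a b) = cbox a b - box a b"
      using ab by (simp add: path_image_rectpath_cbox_minus_box)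
    have eq: "rectpath (a - z) (b - z) t = rectpath a b t - z" for t
      by (simp add: rectpath_def Let_def joinpaths_def linepath_def algebra_simps complex_eq_iff)
    have "winding_number (G \<circ> rectpath a b) 0 = winding_number (L \<circ> rectpath (a - z) (b - z)) 0"
    proof (rule winding_number_nearby_loops_eq)
      show "path (G \<circ> rectpath a b)"
        using * im by (intro path_continuous_image) (auto intro: continuous_on_subset)
      show "path (L \<circ> rectpath (a - z) (b - z))"
        by (intro path_continuous_image) (auto intro: linear_continuous_on lin linear_conv_bounded_linear[THEN iffD1])
      fix t :: real assume t: "t \<in> {0..1}"
      then have r: "rectpath a b t \<in> cbox a b - box a b"
        using im by (auto simp: path_image_def)
      with * have "rectpath a b t \<in> ball z e" "rectpath a b t \<noteq> z" by auto
      then have "norm (G (rectpath a b t) - L (rectpath a b t - z)) \<le> B / 2 * norm (rectpath a b t - z)"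
        using e(2)[of "rectpath a b t"] \<open>G z = 0\<close> by (simp add: dist_norm norm_minus_commute)
      also have "\<dots> < B * norm (rectpath a b t - z)"
        using B(1) \<open>rectpath a b t \<noteq> z\<close> by simp
      also have "\<dots> \<le> norm (L (rectpath a b t - z))"
        by (rule B)
      finally show "norm ((G \<circ> rectpath a b) t - (L \<circ> rectpath (a - z) (b - z)) t) < norm ((L \<circ> rectpath (a - z) (b - z)) t - 0)"
        by (simp add: eq)
    qed (auto simp: pathstart_compose pathfinish_compose)
    also have "\<dots> \<in> {1, -1}"
      using * by (intro winding_number_linear_rectpath lin \<open>inj L\<close>) (auto simp: in_box_complex_iff)
    finally show "winding_number (G \<circ> rectpath a b) 0 \<in> {1, -1}" .
  qed (use e in auto)
qed


text \<open>A nondegenerate zero contributes 1 or -1, and the sign is invisible modulo 2. Two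
  distinct zeros differ in some coordinate; a cut between them leaves fewer zeros on either side,
  which drives the induction.\<close>

lemma rect_turn_parity:
  fixes G :: "complex \<Rightarrow> complex"
  assumes "x \<le> x'" "y \<le> y'"
    and "continuous_on (cbox (Complex x y) (Complex x' y')) G"
    and "finite {z \<in> cbox (Complex x y) (Complex x' y'). G z = 0}"
    and "\<And>z. z \<in> cbox (Complex x y) (Complex x' y') \<Longrightarrow> G z = 0 \<Longrightarrow>
      z \<in> box (Complex x y) (Complex x' y') \<and> (\<exists>L. (G has_derivative L) (at z) \<and> inj L)"
  shows "\<exists>k::int. rect_turn G (Complex x y) (Complex x' y') = of_int k \<and>
     (even k \<longleftrightarrow> even (card {z \<in> cbox (Complex x y) (Complex x' y'). G z = 0}))"
  using assms
proof (induction "card {z \<in> cbox (Complex x y) (Complex x' y'). G z = 0}" arbitrary: x x' y y' rule: less_induct)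
  case less
  define Z where "Z = {z \<in> cbox (Complex x y) (Complex x' y'). G z = 0}"
  note cont = less.prems(3)
  have fin: "finite Z"
    using less.prems(4) by (simp add: Z_def)
  have Z: "z \<in> box (Complex x y) (Complex x' y')" "\<exists>L. (G has_derivative L) (at z) \<and> inj L" if "z \<in> Z" for z
    using less.prems(5) that by (auto simp: Z_def)
  have sub: "continuous_on (cbox (Complex u v) (Complex u' v')) G"
    if "x \<le> u" "u' \<le> x'" "y \<le> v" "v' \<le> y'" for u u' v v'
    using that by (intro continuous_on_subset[OF cont]) (auto simp: in_cbox_complex_iff)
  consider "Z = {}" | z where "Z = {z}" | z1 z2 where "z1 \<in> Z" "z2 \<in> Z" "Re z1 < Re z2"
    | z1 z2 where "z1 \<in> Z" "z2 \<in> Z" "Im z1 < Im z2"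
  proof (cases "Z = {} \<or> (\<exists>z. Z = {z})")
    case False
    then obtain z1 z2 where "z1 \<in> Z" "z2 \<in> Z" "z1 \<noteq> z2" by blast
    then have "Re z1 < Re z2 \<or> Re z2 < Re z1 \<or> Im z1 < Im z2 \<or> Im z2 < Im z1"
      by (auto simp: complex_eq_iff)
    then show ?thesis
      using that(3,4) \<open>z1 \<in> Z\<close> \<open>z2 \<in> Z\<close> by blast
  qed (use that in blast)
  then show ?case
  proof cases
    case 1
    then have "rect_turn G (Complex x y) (Complex x' y') = 0"
      using less.prems(1,2) cont by (intro rect_turn_eq_0) (auto simp: Z_def)
    then show ?thesis
      using 1 by (intro exI[of _ 0]) (simp flip: Z_def)
  next
    case (2 z)
    have zb: "x < Re z" "Re z < x'" "y < Im z" "Im z < y'"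
      using Z(1)[of z] 2 by (auto simp: in_box_complex_iff)
    have G0: "G z = 0"
      using 2 by (auto simp: Z_def)
    have uniq: "w = z" if "w \<in> cbox (Complex x y) (Complex x' y')" "G w = 0" for w
      using 2 that by (auto simp: Z_def)
    obtain L where "(G has_derivative L) (at z)" "inj L"
      using Z(2)[of z] 2 by auto
    then obtain e where e: "e > 0" and
      w: "\<And>a b. z \<in> box a b \<Longrightarrow> cbox a b \<subseteq> ball z e \<Longrightarrow> continuous_on (cbox a b) G \<Longrightarrow>
        winding_number (G \<circ> rectpath a b) 0 \<in> {1, -1}"
      using winding_number_nondegenerate_zero[of G L z] G0 by metis
    \<comment> \<open>The square with half side \<open>d\<close> must fit into the rectangle and
      into the ball. Its points are at distance at most \<open>2 * d\<close> from \<open>z\<close>,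
      hence \<open>e / 4\<close>.\<close>
    define d where "d = Min {e / 4, Re z - x, x' - Re z, Im z - y, y' - Im z}"
    have "d > 0"
      unfolding d_def using e zb by simp
    moreover have "d \<le> t" if "t \<in> {e / 4, Re z - x, x' - Re z, Im z - y, y' - Im z}" for t
      unfolding d_def by (rule Min_le) (use that in auto)
    ultimately have d: "d > 0" "d \<le> e / 4" "d \<le> Re z - x" "d \<le> x' - Re z" "d \<le> Im z - y" "d \<le> y' - Im z"
      by blast+
    define u u' v v' where "u = Re z - d" and "u' = Re z + d" and "v = Im z - d" and "v' = Im z + d"
    have uv: "x \<le> u" "u < Re z" "Re z < u'" "u' \<le> x'" "y \<le> v" "v < Im z" "Im z < v'" "v' \<le> y'"
      using d by (auto simp: u_def u'_def v_def v'_def)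
    \<comment> \<open>Four cuts along the sides of the small square split off rectangles without
      zeros.\<close>
    have "rect_turn G (Complex x y) (Complex x' y') = rect_turn G (Complex x y) (Complex u y') + rect_turn G (Complex u y) (Complex x' y')"
      by (rule rect_turn_split_vertical) (use uv zb cont uniq in \<open>auto simp: in_box_complex_iff\<close>)
    also have "rect_turn G (Complex x y) (Complex u y') = 0"
      by (rule rect_turn_eq_0) (use uv sub in \<open>auto dest!: uniq[rotated] simp: in_cbox_complex_iff\<close>)
    also have "rect_turn G (Complex u y) (Complex x' y') = rect_turn G (Complex u y) (Complex u' y') + rect_turn G (Complex u' y) (Complex x' y')"
      by (rule rect_turn_split_vertical)
         (use uv zb sub in \<open>auto dest!: uniq[rotated] simp: in_box_complex_iff in_cbox_complex_iff\<close>)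
    also have "rect_turn G (Complex u' y) (Complex x' y') = 0"
      by (rule rect_turn_eq_0) (use uv sub in \<open>auto dest!: uniq[rotated] simp: in_cbox_complex_iff\<close>)
    also have "rect_turn G (Complex u y) (Complex u' y') = rect_turn G (Complex u y) (Complex u' v) + rect_turn G (Complex u v) (Complex u' y')"
      by (rule rect_turn_split_horizontal)
         (use uv zb sub in \<open>auto dest!: uniq[rotated] simp: in_box_complex_iff in_cbox_complex_iff\<close>)
    also have "rect_turn G (Complex u y) (Complex u' v) = 0"
      by (rule rect_turn_eq_0) (use uv sub in \<open>auto dest!: uniq[rotated] simp: in_cbox_complex_iff\<close>)
    also have "rect_turn G (Complex u v) (Complex u' y') = rect_turn G (Complex u v) (Complex u' v') + rect_turn G (Complex u v') (Complex u' y')"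
      by (rule rect_turn_split_horizontal)
         (use uv zb sub in \<open>auto dest!: uniq[rotated] simp: in_box_complex_iff in_cbox_complex_iff\<close>)
    also have "rect_turn G (Complex u v') (Complex u' y') = 0"
      by (rule rect_turn_eq_0) (use uv sub in \<open>auto dest!: uniq[rotated] simp: in_cbox_complex_iff\<close>)
    also have "rect_turn G (Complex u v) (Complex u' v') = winding_number (G \<circ> rectpath (Complex u v) (Complex u' v')) 0"
      by (rule rect_turn_eq_winding_number)
         (use uv zb sub in \<open>auto dest!: uniq[rotated] simp: in_box_complex_iff in_cbox_complex_iff\<close>)
    finally have "rect_turn G (Complex x y) (Complex x' y') = winding_number (G \<circ> rectpath (Complex u v) (Complex u' v')) 0"
      by simp
    moreover have "\<dots> \<in> {1, -1}"
    proof (rule w)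
      show "cbox (Complex u v) (Complex u' v') \<subseteq> ball z e"
      proof
        fix t assume "t \<in> cbox (Complex u v) (Complex u' v')"
        then have "\<bar>Re (z - t)\<bar> \<le> d" "\<bar>Im (z - t)\<bar> \<le> d"
          by (auto simp: in_cbox_complex_iff u_def u'_def v_def v'_def)
        then have "norm (z - t) \<le> d + d"
          using cmod_le[of "z - t"] by linarith
        then show "t \<in> ball z e"
          using d e by (simp add: dist_norm)
      qed
    qed (use uv sub in \<open>auto simp: in_box_complex_iff\<close>)
    ultimately have "rect_turn G (Complex x y) (Complex x' y') = of_int 1 \<or>
        rect_turn G (Complex x y) (Complex x' y') = of_int (-1)"
      by simp
    moreover have "\<not> even (card {z \<in> cbox (Complex x y) (Complex x' y'). G z = 0})"
      using 2 by (simp flip: Z_def)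
    ultimately show ?thesis
      using odd_one even_minus[of "1::int"] by blast
  next
    case (3 z1 z2)
    \<comment> \<open>Only finitely many positions are blocked by zeros, so some cut between
      \<open>z1\<close> and \<open>z2\<close> misses all of them.\<close>
    have "infinite ({Re z1<..<Re z2} - Re ` Z)"
      using fin 3(3) by (intro Diff_infinite_finite) auto
    then obtain c where c: "Re z1 < c" "c < Re z2" "c \<notin> Re ` Z"
      by (metis Diff_iff finite.emptyI ex_in_conv greaterThanLessThan_iff)
    have zb: "x < Re z1" "Re z2 < x'" "y < Im z1" "Im z1 < y'" "y < Im z2" "Im z2 < y'"
      using Z(1)[OF 3(1)] Z(1)[OF 3(2)] by (auto simp: in_box_complex_iff)
    define Z1 Z2 where "Z1 = {z \<in> cbox (Complex x y) (Complex c y'). G z = 0}"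
      and "Z2 = {z \<in> cbox (Complex c y) (Complex x' y'). G z = 0}"
    have U: "Z = Z1 \<union> Z2" "Z1 \<inter> Z2 = {}"
      using c zb by (auto simp: Z_def Z1_def Z2_def in_cbox_complex_iff)
    have "z1 \<in> Z1" "z2 \<in> Z2" "z1 \<notin> Z2" "z2 \<notin> Z1"
      using 3 c zb by (auto simp: Z_def Z1_def Z2_def in_cbox_complex_iff)
    then have "Z1 \<subset> Z" "Z2 \<subset> Z"
      using U by auto
    then have card: "card Z1 < card Z" "card Z2 < card Z"
      using fin by (auto intro: psubset_card_mono)
    have split: "rect_turn G (Complex x y) (Complex x' y') =
        rect_turn G (Complex x y) (Complex c y') + rect_turn G (Complex c y) (Complex x' y')"
      by (rule rect_turn_split_vertical) (use c zb cont Z(1) in \<open>auto simp: Z_def\<close>)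
    have *: "z \<in> box (Complex x y) (Complex x' y') \<and> Re z \<noteq> c \<and> (\<exists>L. (G has_derivative L) (at z) \<and> inj L)"
      if "z \<in> Z1 \<union> Z2" for z
      using that Z U c by blast
    obtain k1 :: int where k1: "rect_turn G (Complex x y) (Complex c y') = of_int k1" "even k1 \<longleftrightarrow> even (card Z1)"
    proof -
      have "\<exists>k::int. rect_turn G (Complex x y) (Complex c y') = of_int k \<and> (even k \<longleftrightarrow> even (card Z1))"
        unfolding Z1_def
      proof (rule less.hyps)
        show "card {z \<in> cbox (Complex x y) (Complex c y'). G z = 0} < card {z \<in> cbox (Complex x y) (Complex x' y'). G z = 0}"
          using card(1) by (simp add: Z_def Z1_def)
        show "finite {z \<in> cbox (Complex x y) (Complex c y'). G z = 0}"
          using fin U(1) by (simp flip: Z1_def)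
        show "z \<in> box (Complex x y) (Complex c y') \<and> (\<exists>L. (G has_derivative L) (at z) \<and> inj L)"
          if "z \<in> cbox (Complex x y) (Complex c y')" "G z = 0" for z
          using *[of z] that c by (auto simp: Z1_def in_box_complex_iff in_cbox_complex_iff)
      qed (use c zb sub in auto)
      then show ?thesis
        using that by blast
    qed
    obtain k2 :: int where k2: "rect_turn G (Complex c y) (Complex x' y') = of_int k2" "even k2 \<longleftrightarrow> even (card Z2)"
    proof -
      have "\<exists>k::int. rect_turn G (Complex c y) (Complex x' y') = of_int k \<and> (even k \<longleftrightarrow> even (card Z2))"
        unfolding Z2_def
      proof (rule less.hyps)
        show "card {z \<in> cbox (Complex c y) (Complex x' y'). G z = 0} < card {z \<in> cbox (Complex x y) (Complex x' y'). G z = 0}"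
          using card(2) by (simp add: Z_def Z2_def)
        show "finite {z \<in> cbox (Complex c y) (Complex x' y'). G z = 0}"
          using fin U(1) by (simp flip: Z2_def)
        show "z \<in> box (Complex c y) (Complex x' y') \<and> (\<exists>L. (G has_derivative L) (at z) \<and> inj L)"
          if "z \<in> cbox (Complex c y) (Complex x' y')" "G z = 0" for z
          using *[of z] that c by (auto simp: Z2_def in_box_complex_iff in_cbox_complex_iff)
      qed (use c zb sub in auto)
      then show ?thesis
        using that by blast
    qed
    have "card Z = card Z1 + card Z2"
      using U fin by (simp add: card_Un_disjoint)
    then show ?thesis
      using split k1 k2 by (intro exI[of _ "k1 + k2"]) (simp flip: Z_def)
  next
    case (4 z1 z2)
    have "infinite ({Im z1<..<Im z2} - Im ` Z)"
      using fin 4(3) by (intro Diff_infinite_finite) auto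
    then obtain c where c: "Im z1 < c" "c < Im z2" "c \<notin> Im ` Z"
      by (metis Diff_iff finite.emptyI ex_in_conv greaterThanLessThan_iff)
    have zb: "y < Im z1" "Im z2 < y'" "x < Re z1" "Re z1 < x'" "x < Re z2" "Re z2 < x'"
      using Z(1)[OF 4(1)] Z(1)[OF 4(2)] by (auto simp: in_box_complex_iff)
    define Z1 Z2 where "Z1 = {z \<in> cbox (Complex x y) (Complex x' c). G z = 0}"
      and "Z2 = {z \<in> cbox (Complex x c) (Complex x' y'). G z = 0}"
    have U: "Z = Z1 \<union> Z2" "Z1 \<inter> Z2 = {}"
      using c zb by (auto simp: Z_def Z1_def Z2_def in_cbox_complex_iff)
    have "z1 \<in> Z1" "z2 \<in> Z2" "z1 \<notin> Z2" "z2 \<notin> Z1"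
      using 4 c zb by (auto simp: Z_def Z1_def Z2_def in_cbox_complex_iff)
    then have "Z1 \<subset> Z" "Z2 \<subset> Z"
      using U by auto
    then have card: "card Z1 < card Z" "card Z2 < card Z"
      using fin by (auto intro: psubset_card_mono)
    have split: "rect_turn G (Complex x y) (Complex x' y') =
        rect_turn G (Complex x y) (Complex x' c) + rect_turn G (Complex x c) (Complex x' y')"
      by (rule rect_turn_split_horizontal) (use c zb cont Z(1) in \<open>auto simp: Z_def\<close>)
    have *: "z \<in> box (Complex x y) (Complex x' y') \<and> Im z \<noteq> c \<and> (\<exists>L. (G has_derivative L) (at z) \<and> inj L)"
      if "z \<in> Z1 \<union> Z2" for z
      using that Z U c by blast
    obtain k1 :: int where k1: "rect_turn G (Complex x y) (Complex x' c) = of_int k1" "even k1 \<longleftrightarrow> even (card Z1)"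
    proof -
      have "\<exists>k::int. rect_turn G (Complex x y) (Complex x' c) = of_int k \<and> (even k \<longleftrightarrow> even (card Z1))"
        unfolding Z1_def
      proof (rule less.hyps)
        show "card {z \<in> cbox (Complex x y) (Complex x' c). G z = 0} < card {z \<in> cbox (Complex x y) (Complex x' y'). G z = 0}"
          using card(1) by (simp add: Z_def Z1_def)
        show "finite {z \<in> cbox (Complex x y) (Complex x' c). G z = 0}"
          using fin U(1) by (simp flip: Z1_def)
        show "z \<in> box (Complex x y) (Complex x' c) \<and> (\<exists>L. (G has_derivative L) (at z) \<and> inj L)"
          if "z \<in> cbox (Complex x y) (Complex x' c)" "G z = 0" for z
          using *[of z] that c by (auto simp: Z1_def in_box_complex_iff in_cbox_complex_iff)
      qed (use c zb sub in auto)
      then show ?thesis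
        using that by blast
    qed
    obtain k2 :: int where k2: "rect_turn G (Complex x c) (Complex x' y') = of_int k2" "even k2 \<longleftrightarrow> even (card Z2)"
    proof -
      have "\<exists>k::int. rect_turn G (Complex x c) (Complex x' y') = of_int k \<and> (even k \<longleftrightarrow> even (card Z2))"
        unfolding Z2_def
      proof (rule less.hyps)
        show "card {z \<in> cbox (Complex x c) (Complex x' y'). G z = 0} < card {z \<in> cbox (Complex x y) (Complex x' y'). G z = 0}"
          using card(2) by (simp add: Z_def Z2_def)
        show "finite {z \<in> cbox (Complex x c) (Complex x' y'). G z = 0}"
          using fin U(1) by (simp flip: Z2_def)
        show "z \<in> box (Complex x c) (Complex x' y') \<and> (\<exists>L. (G has_derivative L) (at z) \<and> inj L)"
          if "z \<in> cbox (Complex x c) (Complex x' y')" "G z = 0" for z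
          using *[of z] that c by (auto simp: Z2_def in_box_complex_iff in_cbox_complex_iff)
      qed (use c zb sub in auto)
      then show ?thesis
        using that by blast
    qed
    have "card Z = card Z1 + card Z2"
      using U fin by (simp add: card_Un_disjoint)
    then show ?thesis
      using split k1 k2 by (intro exI[of _ "k1 + k2"]) (simp flip: Z_def)
  qed
qed

section \<open>Crossing parity of two plane paths\<close>

lemma winding_number_minus_path:
  assumes "path p" "z \<notin> path_image p"
  shows "winding_number (\<lambda>t. z - p t) 0 = winding_number p z"
proof -
  have "winding_number (\<lambda>t. z - p t) 0 = winding_number (\<lambda>t. -1 * (p t - z)) 0"
    by simp
  also have "\<dots> = winding_number (\<lambda>t. p t - z) 0"
    using assms by (intro winding_number_mult_const)
      (auto simp: path_def path_image_def intro!: continuous_intros)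
  finally show ?thesis
    by (simp flip: winding_number_offset)
qed

text \<open>The parameter square is placed in the complex plane as \<open>Complex s t\<close>. At a
  zero of \<open>p s - q t\<close>, independence of the tangents is injectivity of the derivative.
  On horizontal sides \<open>t\<close> is fixed, which gives \<open>p\<close> around an end of
  \<open>q\<close>; vertical sides give \<open>q\<close> around an end of \<open>p\<close>.\<close>

lemma crossing_parity:
  fixes p q :: "real \<Rightarrow> complex"
  assumes "path p" "path q"
    and fin: "finite {(s, t). s \<in> {0..1} \<and> t \<in> {0..1} \<and> p s = q t}"
    and cr: "\<And>s t. s \<in> {0..1} \<Longrightarrow> t \<in> {0..1} \<Longrightarrow> p s = q t \<Longrightarrow>
       s \<in> {0<..<1} \<and> t \<in> {0<..<1} \<and>
       (\<exists>D E. (p has_vector_derivative D) (at s) \<and> (q has_vector_derivative E) (at t) \<and>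
          (\<forall>u v. u *\<^sub>R D = v *\<^sub>R E \<longrightarrow> u = 0 \<and> v = 0))"
  shows "\<exists>k::int. winding_number p (q 0) + winding_number q (p 1) - winding_number p (q 1) - winding_number q (p 0) = of_int k
      \<and> (even k \<longleftrightarrow> even (card {(s, t). s \<in> {0..1} \<and> t \<in> {0..1} \<and> p s = q t}))"
proof -
  define G where "G = (\<lambda>z. p (Re z) - q (Im z))"
  let ?B = "cbox (Complex 0 0) (Complex 1 1)"
  have cont: "continuous_on ?B G"
    unfolding G_def using assms(1,2)[unfolded path_def]
    by (intro continuous_on_diff continuous_on_compose2[of "{0..1}" p ?B Re] continuous_on_compose2[of "{0..1}" q ?B Im])
       (auto simp: in_cbox_complex_iff continuous_on_Re continuous_on_Im)
  have bij: "bij_betw (\<lambda>z. (Re z, Im z)) {z \<in> ?B. G z = 0} {(s, t). s \<in> {0..1} \<and> t \<in> {0..1} \<and> p s = q t}"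
    by (rule bij_betwI[where g = "\<lambda>(s,t). Complex s t"]) (auto simp: G_def in_cbox_complex_iff)
  have zero: "z \<in> box (Complex 0 0) (Complex 1 1) \<and> (\<exists>L. (G has_derivative L) (at z) \<and> inj L)"
    if "z \<in> ?B" "G z = 0" for z
  proof -
    have z: "Re z \<in> {0..1}" "Im z \<in> {0..1}" "p (Re z) = q (Im z)"
      using that by (auto simp: G_def in_cbox_complex_iff)
    obtain D E where D: "(p has_vector_derivative D) (at (Re z))" "(q has_vector_derivative E) (at (Im z))"
      and ind: "\<And>u v. u *\<^sub>R D = v *\<^sub>R E \<Longrightarrow> u = 0 \<and> v = 0"
      using cr[OF z] by blast
    have "(G has_derivative (\<lambda>h. Re h *\<^sub>R D - Im h *\<^sub>R E)) (at z)"
    proof -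
      have "(p \<circ> Re has_derivative (\<lambda>h. h *\<^sub>R D) \<circ> Re) (at z)"
        using diff_chain_at[OF bounded_linear_imp_has_derivative[OF bounded_linear_Re]] D(1)
        by (simp add: has_vector_derivative_def)
      moreover have "(q \<circ> Im has_derivative (\<lambda>h. h *\<^sub>R E) \<circ> Im) (at z)"
        using diff_chain_at[OF bounded_linear_imp_has_derivative[OF bounded_linear_Im]] D(2)
        by (simp add: has_vector_derivative_def)
      ultimately show ?thesis
        unfolding G_def comp_def by (rule has_derivative_diff)
    qed
    moreover have "inj (\<lambda>h. Re h *\<^sub>R D - Im h *\<^sub>R E)"
    proof (rule injI)
      fix x y assume "Re x *\<^sub>R D - Im x *\<^sub>R E = Re y *\<^sub>R D - Im y *\<^sub>R E"
      then have "(Re x - Re y) *\<^sub>R D = (Im x - Im y) *\<^sub>R E"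
        by (simp add: algebra_simps)
      from ind[OF this] show "x = y"
        by (simp add: complex_eq_iff)
    qed
    ultimately show ?thesis
      using cr[OF z] by (auto simp: in_box_complex_iff)
  qed
  have nz: "G z \<noteq> 0" if "z \<in> ?B - box (Complex 0 0) (Complex 1 1)" for z
    using zero that by blast
  have bd: "p s \<noteq> q t" if "s \<in> {0,1} \<and> t \<in> {0..1} \<or> t \<in> {0,1} \<and> s \<in> {0..1}" for s t
    using cr[of s t] that by auto
  have "\<exists>k::int. rect_turn G (Complex 0 0) (Complex 1 1) = of_int k \<and> (even k \<longleftrightarrow> even (card {z \<in> ?B. G z = 0}))"
    by (rule rect_turn_parity) (use cont zero bij_betw_finite[OF bij] fin in auto)
  moreover have "rect_turn G (Complex 0 0) (Complex 1 1) = turn G (Complex 0 0) (Complex 1 0) + turn G (Complex 1 0) (Complex 1 1)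
     - turn G (Complex 0 1) (Complex 1 1) - turn G (Complex 0 0) (Complex 0 1)"
    by (rule rect_turn_alt) (use cont nz in auto)
  moreover have "turn G (Complex 0 y) (Complex 1 y) = winding_number p (q y)" if "y \<in> {0,1}" for y
    unfolding turn_def
    by (subst winding_number_offset[of p]) (simp add: G_def comp_def linepath_def algebra_simps)
  moreover have "turn G (Complex x 0) (Complex x 1) = winding_number q (p x)" if "x \<in> {0,1}" for x
  proof -
    have "turn G (Complex x 0) (Complex x 1) = winding_number (\<lambda>t. p x - q t) 0"
      by (simp add: turn_def G_def comp_def linepath_def algebra_simps)
    also have "\<dots> = winding_number q (p x)"
      using assms(2) bd that by (intro winding_number_minus_path) (auto simp: path_image_def)
    finally show ?thesis .
  qed
  ultimately show ?thesis
    using bij_betw_same_card[OF bij] by simp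
qed

text \<open>Both sides, up to the integer term, are logarithms of the quotient of the two end
  directions seen from \<open>z\<close>.\<close>

lemma winding_number_log_diff:
  assumes "path p" "z \<notin> path_image p" "exp a = pathstart p - z" "exp b = pathfinish p - z"
  shows "\<exists>n::int. 2 * of_real pi * \<i> * winding_number p z = b - a + 2 * of_real pi * \<i> * of_int n"
proof -
  have "exp b = exp (2 * of_real pi * \<i> * winding_number p z + a)"
    using winding_number_exp_2pi[OF assms(1,2)] assms(3,4) by (simp add: exp_add)
  then obtain n :: int where "b = 2 * of_real pi * \<i> * winding_number p z + a + of_int (2 * n) * (of_real pi * \<i>)"
    unfolding exp_eq by auto
  then show ?thesis
    by (intro exI[of _ "- n"]) simp
qed

text \<open>Here \<open>p\<close> runs from \<open>a\<close> to \<open>b\<close>, \<open>q\<close>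
  from \<open>c\<close> to \<open>d\<close>, and \<open>l x y\<close> stands for a logarithm of the
  direction from \<open>x\<close> to \<open>y\<close>. In the alternating sum every direction meets
  its opposite, so \<open>l\<close> survives only through \<open>h\<close>. The \<open>k\<close> of
  the conclusion depends on \<open>h\<close> alone.\<close>

lemma crossing_parity_log:
  fixes p q :: "real \<Rightarrow> complex" and l :: "'a \<Rightarrow> 'a \<Rightarrow> complex" and h :: "'a \<Rightarrow> 'a \<Rightarrow> int"
    and n\<^sub>a n\<^sub>b n\<^sub>c n\<^sub>d :: int
  assumes "path p" "path q"
    and fin: "finite {(s, t). s \<in> {0..1} \<and> t \<in> {0..1} \<and> p s = q t}"
    and cr: "\<And>s t. s \<in> {0..1} \<Longrightarrow> t \<in> {0..1} \<Longrightarrow> p s = q t \<Longrightarrow>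
       s \<in> {0<..<1} \<and> t \<in> {0<..<1} \<and>
       (\<exists>D E. (p has_vector_derivative D) (at s) \<and> (q has_vector_derivative E) (at t) \<and>
          (\<forall>u v. u *\<^sub>R D = v *\<^sub>R E \<longrightarrow> u = 0 \<and> v = 0))"
    and h: "\<And>x y. x \<noteq> y \<Longrightarrow> l y x - l x y = of_int (h x y) * (of_real pi * \<i>)"
    and ne: "a \<noteq> c" "a \<noteq> d" "b \<noteq> c" "b \<noteq> d"
    and n: "2 * of_real pi * \<i> * winding_number p (q 0) = l c b - l c a + 2 * of_real pi * \<i> * of_int n\<^sub>c"
      "2 * of_real pi * \<i> * winding_number p (q 1) = l d b - l d a + 2 * of_real pi * \<i> * of_int n\<^sub>d"
      "2 * of_real pi * \<i> * winding_number q (p 0) = l a d - l a c + 2 * of_real pi * \<i> * of_int n\<^sub>a"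
      "2 * of_real pi * \<i> * winding_number q (p 1) = l b d - l b c + 2 * of_real pi * \<i> * of_int n\<^sub>b"
  shows "\<exists>k. 2 * k = h b c + h d b + h a d + h c a \<and>
    (even (card {(s, t). s \<in> {0..1} \<and> t \<in> {0..1} \<and> p s = q t}) \<longleftrightarrow> even (n\<^sub>a + n\<^sub>b + n\<^sub>c + n\<^sub>d + k))"
proof -
  obtain k :: int where k: "winding_number p (q 0) + winding_number q (p 1) - winding_number p (q 1) - winding_number q (p 0) = of_int k"
    "even k \<longleftrightarrow> even (card {(s, t). s \<in> {0..1} \<and> t \<in> {0..1} \<and> p s = q t})"
    using crossing_parity[OF assms(1,2) fin cr] by blast
  define N where "N = n\<^sub>c + n\<^sub>b - n\<^sub>d - n\<^sub>a"
  have "of_real pi * \<i> * of_int (2 * k) = 2 * of_real pi * \<i> * (winding_number p (q 0) + winding_number q (p 1) - winding_number p (q 1) - winding_number q (p 0))"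
    by (simp add: k)
  also have "\<dots> = (l c b - l b c) + (l b d - l d b) + (l d a - l a d) + (l a c - l c a) + 2 * of_real pi * \<i> * of_int N"
    unfolding distrib_left right_diff_distrib n N_def by (simp add: algebra_simps)
  also have "\<dots> = of_real pi * \<i> * of_int (h b c + h d b + h a d + h c a + 2 * N)"
    using ne by (simp add: h algebra_simps)
  finally have "(of_int (2 * k) :: complex) = of_int (h b c + h d b + h a d + h c a + 2 * N)"
    by (simp del: of_int_mult of_int_add)
  then have "2 * k = h b c + h d b + h a d + h c a + 2 * N"
    by (simp only: of_int_eq_iff)
  \<comment> \<open>Subtracting \<open>N\<close> isolates the part given by \<open>h\<close>; the
    signs within \<open>N\<close> do not matter modulo 2.\<close>
  then show ?thesis
    using k(2) by (intro exI[of _ "k - N"]) (auto simp: N_def)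
qed

section \<open>Subspaces of the circle\<close>

abbreviation circle :: "(real ^ 2) set" where
  "circle \<equiv> sphere 0 1"

lemma circle_avoids_two_points: "\<exists>z\<in>circle. z \<noteq> x \<and> z \<noteq> y"
proof -
  have "axis 1 1 \<in> circle" "axis 2 1 \<in> circle" "- axis 1 1 \<in> circle"
    by simp_all
  moreover have "axis 1 1 \<noteq> (axis 2 1 :: real ^ 2)" "axis 1 1 \<noteq> - (axis 1 1 :: real ^ 2)"
    "axis 2 1 \<noteq> - (axis 1 1 :: real ^ 2)"
    by (simp_all add: vec_eq_iff forall_2 axis_def)
  ultimately show ?thesis
    by metis
qed

lemma connected_circle_minus_point: "connected (circle - {p})"
proof (cases "p \<in> circle")
  case True
  have "circle - {p} homeomorphic {x::real ^ 2. axis 2 1 \<bullet> x = 0}"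
    using True by (intro homeomorphic_punctured_sphere_hyperplane) auto
  then show ?thesis
    using homeomorphic_connectedness convex_connected convex_hyperplane by metis
next
  case False
  then show ?thesis
    by (simp add: connected_sphere)
qed

text \<open>Stereographic projection onto the line \<open>x $ 2 = 0\<close>, followed by the first
  coordinate.\<close>

lemma circle_minus_point_embeds_in_line:
  assumes "p \<in> circle"
  shows "\<exists>g::real ^ 2 \<Rightarrow> real. continuous_on (circle - {p}) g \<and> inj_on g (circle - {p})"
proof -
  have "circle - {p} homeomorphic {x::real ^ 2. axis 2 1 \<bullet> x = 0}"
    using assms by (intro homeomorphic_punctured_sphere_hyperplane) auto
  then obtain h k where hk: "homeomorphism (circle - {p}) {x::real ^ 2. axis 2 1 \<bullet> x = 0} h k"
    unfolding homeomorphic_def by blast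
  let ?g = "\<lambda>z. h z $ 1"
  have "continuous_on (circle - {p}) ?g"
    using hk by (intro continuous_intros) (simp add: homeomorphism_def)
  moreover have "inj_on ?g (circle - {p})"
  proof (rule inj_onI)
    fix x y assume xy: "x \<in> circle - {p}" "y \<in> circle - {p}" "h x $ 1 = h y $ 1"
    then have "h x \<in> {x. axis 2 1 \<bullet> x = 0}" "h y \<in> {x. axis 2 1 \<bullet> x = 0}"
      using hk unfolding homeomorphism_def by blast+
    then have "h x = h y"
      using xy(3) by (simp add: vec_eq_iff forall_2 inner_axis')
    then show "x = y"
      using xy hk unfolding homeomorphism_def by metis
  qed
  ultimately show ?thesis by blast
qed

text \<open>Deleting the only possible point at level \<open>c\<close> leaves a connected set.
  Values below and above \<open>c\<close> on it would force the value \<open>c\<close>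
  again.\<close>

lemma level_set_of_circle:
  fixes h :: "'a::topological_space \<Rightarrow> real"
  assumes S: "S homeomorphic circle" and h: "continuous_on S h"
    and lev: "{z \<in> S. h z = c} \<subseteq> {p}" and "x \<in> S" "y \<in> S" "h x < c" 
  shows "h y \<le> c"
proof (rule ccontr)
  assume "\<not> h y \<le> c"
  obtain f g where fg: "homeomorphism S circle f g"
    using S unfolding homeomorphic_def by blast
  define k where "k = h \<circ> g"
  have k: "continuous_on circle k"
    unfolding k_def using fg h by (intro continuous_on_compose) (auto simp: homeomorphism_def)
  define q where "q = f p"
  have kq: "z = q" if "z \<in> circle" "k z = c" for z
  proof -
    have "g z \<in> {z \<in> S. h z = c}"
      using that fg by (auto simp: k_def homeomorphism_def)
    then have "g z = p"
      using lev by blast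
    then show ?thesis
      using fg that by (auto simp: q_def homeomorphism_def)
  qed
  have fxy: "f x \<in> circle" "f y \<in> circle" "k (f x) < c" "k (f y) > c"
    using fg assms(4-6) \<open>\<not> h y \<le> c\<close> by (auto simp: k_def homeomorphism_def)
  define T where "T = (if q \<in> circle \<and> k q = c then circle - {q} else circle)"
  have "connected T"
    using connected_circle_minus_point[of q] by (simp add: T_def connected_sphere)
  moreover have "continuous_on T k"
    by (rule continuous_on_subset[OF k]) (auto simp: T_def)
  ultimately have "connected (k ` T)"
    by (rule connected_continuous_image[rotated])
  moreover have "k (f x) \<in> k ` T" "k (f y) \<in> k ` T"
    using fxy by (auto simp: T_def)
  ultimately have "c \<in> k ` T"
    using fxy unfolding connected_iff_interval by (metis less_imp_le)
  then obtain z where "z \<in> T" "k z = c" by blast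
  then show False
    using kq[of z] by (auto simp: T_def split: if_splits)
qed

text \<open>A proper subset misses a point of \<open>R\<close> and so maps injectively into the
  line. Among three points of \<open>S\<close>, the one with the middle value is alone on its level,
  with smaller and larger values elsewhere, against \<open>level_set_of_circle\<close>.\<close>

lemma circle_subset_circle:
  fixes R S :: "'a::t2_space set"
  assumes S: "S homeomorphic circle" and R: "R homeomorphic circle" and "S \<subseteq> R"
  shows "S = R"
proof (rule ccontr)
  assume "S \<noteq> R"
  then obtain p where p: "p \<in> R" "p \<notin> S"
    using assms(3) by blast
  obtain f f' where f: "homeomorphism R circle f f'"
    using R unfolding homeomorphic_def by blast
  have "f p \<in> circle"
    using f p by (auto simp: homeomorphism_def)
  then obtain g :: "real ^ 2 \<Rightarrow> real" where g: "continuous_on (circle - {f p}) g" "inj_on g (circle - {f p})"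
    using circle_minus_point_embeds_in_line by blast
  have injR: "inj_on f R"
    using f by (intro inj_on_inverseI[of R f' f]) (simp add: homeomorphism_def)
  then have injf: "inj_on f S"
    using assms(3) inj_on_subset by blast
  have "f ` R = circle"
    using f by (simp add: homeomorphism_def)
  then have fS: "f ` S \<subseteq> circle - {f p}"
    using p assms(3) inj_onD[OF injR] by blast
  let ?h = "g \<circ> f"
  have h: "continuous_on S ?h"
  proof (rule continuous_on_compose)
    show "continuous_on S f"
      using homeomorphism_cont1[OF f] assms(3) by (rule continuous_on_subset)
    show "continuous_on (f ` S) g"
      using g(1) fS by (rule continuous_on_subset)
  qed
  have inj: "inj_on ?h S"
    by (rule comp_inj_on[OF injf inj_on_subset[OF g(2) fS]])
  obtain s s' where s: "homeomorphism S circle s s'"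
    using S unfolding homeomorphic_def by blast
  obtain a b c where "a \<in> S" "b \<in> S" "c \<in> S" "a \<noteq> b" "b \<noteq> c" "a \<noteq> c"
  proof -
    obtain a b c where abc: "a \<in> circle" "b \<in> circle" "c \<in> circle" "a \<noteq> b" "b \<noteq> c" "a \<noteq> c"
      using circle_avoids_two_points by metis
    have "inj_on s' circle" "s' ` circle = S"
      using s by (auto simp: homeomorphism_def intro: inj_on_inverseI[of circle s s'])
    then show ?thesis
      using abc by (intro that[of "s' a" "s' b" "s' c"]) (auto dest: inj_onD)
  qed
  then have *: "?h a \<noteq> ?h b" "?h b \<noteq> ?h c" "?h a \<noteq> ?h c"
    using inj by (auto simp: inj_on_def)
  have "\<not> (?h x < ?h y \<and> ?h y < ?h z)" if "x \<in> S" "y \<in> S" "z \<in> S" for x y z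
  proof -
    have "{w \<in> S. ?h w = ?h y} \<subseteq> {y}"
      using inj that by (auto simp: inj_on_def)
    from level_set_of_circle[OF S h this that(1,3)] show ?thesis
      by linarith
  qed
  note no = this
  show False
    using no[of a b c] no[of a c b] no[of b a c] no[of b c a] no[of c a b] no[of c b a] *
      \<open>a \<in> S\<close> \<open>b \<in> S\<close> \<open>c \<in> S\<close> by linarith
qed

section \<open>The space of a graph\<close>

lemma edge_path_nth:
  "edge_path a b t $ v = (1 - t) * (if v = a then 1 else 0) + t * (if v = b then 1 else 0)"
  by (simp add: edge_path_def linepath_def axis_def)

text \<open>Points of the space are compared through their coordinates at the four ends. Only
  \<open>s\<close> is assumed to be interior; an end of the second edge never satisfies the
  equation.\<close>

lemma edge_path_eq_iff:
  assumes "a \<noteq> b" "c \<noteq> d" "s \<in> {0<..<1}" "t \<in> {0..1}"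
  shows "edge_path a b s = edge_path c d t \<longleftrightarrow> a = c \<and> b = d \<and> s = t \<or> a = d \<and> b = c \<and> s = 1 - t"
proof
  assume eq: "edge_path a b s = edge_path c d t"
  have n: "(1 - s) * (if v = a then 1 else 0) + s * (if v = b then 1 else 0)
    = (1 - t) * (if v = c then 1 else 0) + t * (if v = d then 1 else 0)" for v
    using arg_cong[OF eq, of "\<lambda>z. z $ v"] by (simp add: edge_path_nth)
  show "a = c \<and> b = d \<and> s = t \<or> a = d \<and> b = c \<and> s = 1 - t"
    using n[of a] n[of b] n[of c] n[of d] assms by (auto split: if_splits)
next
  assume "a = c \<and> b = d \<and> s = t \<or> a = d \<and> b = c \<and> s = 1 - t"
  then show "edge_path a b s = edge_path c d t"
    by (auto simp: vec_eq_iff edge_path_nth)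
qed

lemma edge_path_neq_axis:
  assumes "a \<noteq> b" "s \<in> {0<..<1}"
  shows "edge_path a b s \<noteq> axis v 1"
proof
  assume eq: "edge_path a b s = axis v 1"
  have "(1 - s) * (if w = a then 1 else 0) + s * (if w = b then 1 else 0) = (if w = v then 1 else 0)" for w
    using arg_cong[OF eq, of "\<lambda>z. z $ w"] by (simp add: edge_path_nth axis_def)
  from this[of a] this[of b] this[of v] show False
    using assms by (auto split: if_splits)
qed

lemma convex_hull_edge:
  "convex hull ((\<lambda>v. axis v 1) ` {a, b}) = edge_path a b ` {0..1}"
  by (simp add: edge_path_def linepath_image_01 flip: segment_convex_hull)

text \<open>Graphs are arbitrary pairs of sets. Asking for two elements excludes loops, on which
  \<open>edge_path\<close> would be constant.\<close>

definition simple_graph :: "'v graph \<Rightarrow> bool" where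
  "simple_graph H \<longleftrightarrow> (\<forall>e\<in>snd H. card e = 2) \<and> \<Union>(snd H) \<subseteq> fst H"

lemma simple_graph_edge:
  assumes "simple_graph H" "e \<in> snd H"
  obtains a b where "e = {a, b}" "a \<noteq> b" "a \<in> fst H" "b \<in> fst H"
  using assms unfolding simple_graph_def
  by (metis UnionI card_2_iff insertCI subset_iff)

lemma simple_graph_edgeD:
  assumes "simple_graph H" "{a, b} \<in> snd H"
  shows "a \<noteq> b" "a \<in> fst H" "b \<in> fst H"
proof -
  show "a \<noteq> b"
    using assms unfolding simple_graph_def by fastforce
  show "a \<in> fst H" "b \<in> fst H"
    using assms unfolding simple_graph_def by blast+
qed

lemma simple_graph_subgraph:
  "subgraph H G \<Longrightarrow> simple_graph G \<Longrightarrow> simple_graph H"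
  by (auto simp: simple_graph_def subgraph_def)

lemma edge_path_in_realization:
  assumes "{a, b} \<in> snd H" "t \<in> {0..1}"
  shows "edge_path a b t \<in> realization H"
  using assms convex_hull_edge[of a b] by (force simp: realization_def)

lemma realization_cases:
  assumes "simple_graph H" "z \<in> realization H"
  obtains v where "v \<in> fst H" "z = axis v 1" 
    | a b t where "{a, b} \<in> snd H" "a \<noteq> b" "t \<in> {0<..<1}" "z = edge_path a b t"
proof -
  consider v where "v \<in> fst H" "z = axis v 1" | e where "e \<in> snd H" "z \<in> convex hull ((\<lambda>v. axis v 1) ` e)"
    using assms(2) by (auto simp: realization_def)
  then show ?thesis
  proof cases
    case (2 e)
    then obtain a b where ab: "e = {a, b}" "a \<noteq> b" "a \<in> fst H" "b \<in> fst H"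
      using simple_graph_edge[OF assms(1)] by metis
    then obtain t where t: "t \<in> {0..1}" "z = edge_path a b t"
      using 2(2) convex_hull_edge[of a b] by auto
    then consider "t = 0" | "t = 1" | "t \<in> {0<..<1}" by force
    then show ?thesis
      using that t 2 ab by cases (auto simp: edge_path_def linepath_def)
  qed (use that in blast)
qed

lemma axis_in_realization_iff:
  assumes "simple_graph H"
  shows "axis v 1 \<in> realization H \<longleftrightarrow> v \<in> fst H"
proof
  assume "axis v 1 \<in> realization H"
  then show "v \<in> fst H"
  proof (cases rule: realization_cases[OF assms, consumes 1, case_names 1 2])
    case (1 w)
    then show ?thesis by (simp add: axis_eq_axis)
  next
    case (2 a b t)
    then show ?thesis using edge_path_neq_axis by metis
  qed
qed (auto simp: realization_def)

text \<open>Together with \<open>axis_in_realization_iff\<close> this reads the graph off its space,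
  so equal spaces mean equal graphs.\<close>

lemma edge_path_in_realization_iff:
  assumes "simple_graph H" "a \<noteq> b" "t \<in> {0<..<1}"
  shows "edge_path a b t \<in> realization H \<longleftrightarrow> {a, b} \<in> snd H"
proof
  assume "edge_path a b t \<in> realization H"
  then show "{a, b} \<in> snd H"
  proof (cases rule: realization_cases[OF assms(1), consumes 1, case_names 1 2])
    case (1 w)
    then show ?thesis using edge_path_neq_axis[OF assms(2,3)] by metis
  next
    case (2 c d s)
    then show ?thesis
      using edge_path_eq_iff[OF assms(2) _ assms(3), of c d s] by (auto simp: insert_commute)
  qed
qed (use assms in \<open>auto intro: edge_path_in_realization\<close>)

section \<open>Paths and cycles given by vertex lists\<close>

fun path_edges :: "'a list \<Rightarrow> 'a set set" where
  "path_edges (x # y # zs) = insert {x, y} (path_edges (y # zs))"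
| "path_edges _ = {}"

text \<open>For a list of length 2 the closing edge repeats the only path edge, hence the bound 3 on
  lengths below.\<close>

definition cycle_edges :: "'a list \<Rightarrow> 'a set set" where
  "cycle_edges xs = insert {hd xs, last xs} (path_edges xs)"

lemma path_edges_subset: "e \<in> path_edges xs \<Longrightarrow> e \<subseteq> set xs"
  by (induction xs rule: path_edges.induct) auto

lemma path_edges_card: "distinct xs \<Longrightarrow> e \<in> path_edges xs \<Longrightarrow> card e = 2"
  by (induction xs rule: path_edges.induct) auto

lemma simple_graph_path: "distinct xs \<Longrightarrow> simple_graph (set xs, path_edges xs)"
  using path_edges_subset path_edges_card by (fastforce simp: simple_graph_def)

lemma hd_neq_last: "distinct xs \<Longrightarrow> length xs \<ge> 2 \<Longrightarrow> hd xs \<noteq> last xs"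
  by (cases xs) (auto split: if_splits)

lemma simple_graph_cycle:
  assumes "distinct xs" "length xs \<ge> 2"
  shows "simple_graph (set xs, cycle_edges xs)"
  using simple_graph_path[OF assms(1)] hd_neq_last[OF assms] assms(2)
  by (cases xs) (auto simp: simple_graph_def cycle_edges_def)

lemma closing_edge_notin_path_edges:
  assumes "distinct xs" "length xs \<ge> 3"
  shows "{hd xs, last xs} \<notin> path_edges xs"
proof -
  obtain x y zs where xs: "xs = x # y # zs" "zs \<noteq> []"
    using assms(2) by (cases xs; cases "tl xs") (auto simp: Suc_le_eq)
  then have "last xs \<in> set zs" "last xs \<noteq> y" "x \<notin> set (y # zs)"
    using assms(1) by auto
  then show ?thesis
    using xs path_edges_subset[of "{x, last xs}" "y # zs"] by (auto simp: doubleton_eq_iff)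
qed

lemma finite_path_edges: "finite (path_edges xs)"
  by (induction xs rule: path_edges.induct) auto

lemma card_path_edges: "distinct xs \<Longrightarrow> card (path_edges xs) = length xs - 1"
proof (induction xs rule: path_edges.induct)
  case (1 x y zs)
  have "{x, y} \<notin> path_edges (y # zs)"
    using path_edges_subset[of "{x, y}" "y # zs"] 1(2) by auto
  then show ?case
    using 1 by (simp add: finite_path_edges)
qed auto

lemma card_cycle_edges:
  assumes "distinct xs" "length xs \<ge> 3"
  shows "card (cycle_edges xs) = length xs"
  using closing_edge_notin_path_edges[OF assms] card_path_edges[OF assms(1)] assms(2)
  by (simp add: cycle_edges_def finite_path_edges)

lemma realization_insert_edge:
  "realization (insert a (insert b V), insert {a, b} E) = edge_path a b ` {0..1} \<union> realization (V, E)"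
proof -
  have "axis a 1 = edge_path a b 0" "axis b 1 = edge_path a b 1"
    by (simp_all add: edge_path_def linepath_def)
  then have "axis a 1 \<in> edge_path a b ` {0..1}" "axis b 1 \<in> edge_path a b ` {0..1}"
    by auto
  then show ?thesis
    using convex_hull_edge[of a b] by (auto simp: realization_def)
qed

lemma arc_edge_path: "a \<noteq> b \<Longrightarrow> arc (edge_path a b)"
  by (simp add: edge_path_def arc_linepath axis_eq_axis)

lemma edge_path_start_finish [simp]:
  "pathstart (edge_path a b) = axis a 1" "pathfinish (edge_path a b) = axis b 1"
  "edge_path a b 0 = axis a 1" "edge_path a b (Suc 0) = axis b 1" "edge_path a b 1 = axis b 1"
  by (simp_all add: edge_path_def linepath_def pathstart_def pathfinish_def)

text \<open>A prepended edge meets the rest of the path only in the vertex \<open>y\<close>, since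
  neither its interior nor its start belongs to the remaining graph.\<close>

lemma realization_path_arc:
  assumes "distinct xs" "length xs \<ge> 2"
  shows "\<exists>g. arc g \<and> pathstart g = axis (hd xs) 1 \<and> pathfinish g = axis (last xs) 1 \<and>
    path_image g = realization (set xs, path_edges xs)"
  using assms
proof (induction xs rule: path_edges.induct)
  case (1 x y zs)
  show ?case
  proof (cases "zs = []")
    case True
    have "realization ({x, y}, {{x, y}}) = edge_path x y ` {0..1} \<union> realization ({}, {})"
      by (rule realization_insert_edge)
    then show ?thesis
      using True 1(2) by (intro exI[of _ "edge_path x y"]) (simp add: arc_edge_path path_image_def realization_def)
  next
    case False
    have d: "x \<noteq> y" "x \<notin> set zs" "distinct (y # zs)" "length (y # zs) \<ge> 2"
      using 1(2) False by (auto simp: Suc_le_eq)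
    obtain g where g: "arc g" "pathstart g = axis y 1" "pathfinish g = axis (last zs) 1"
      "path_image g = realization (set (y # zs), path_edges (y # zs))"
      using 1(1)[OF d(3,4)] False by auto
    have "path_image (edge_path x y) \<inter> path_image g \<subseteq> {axis y 1}"
    proof
      fix z assume "z \<in> path_image (edge_path x y) \<inter> path_image g"
      then obtain t where t: "t \<in> {0..1}" "z = edge_path x y t" and z: "z \<in> realization (set (y # zs), path_edges (y # zs))"
        using g(4) by (auto simp: path_image_def)
      have sg: "simple_graph (set (y # zs), path_edges (y # zs))"
        by (rule simple_graph_path[OF d(3)])
      have "t \<noteq> 0"
        using axis_in_realization_iff[OF sg, of x] z t d by auto
      moreover have "{x, y} \<notin> path_edges (y # zs)"
        using path_edges_subset[of "{x, y}" "y # zs"] d by auto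
      then have "t \<notin> {0<..<1}"
        using edge_path_in_realization_iff[OF sg d(1), of t] z t by auto
      ultimately have "t = 1"
        using t by auto
      then show "z \<in> {axis y 1}"
        using t by simp
    qed
    then have "arc (edge_path x y +++ g)"
      using g d by (intro arc_join arc_edge_path) auto
    moreover have "path_image (edge_path x y +++ g) = realization (set (x # y # zs), path_edges (x # y # zs))"
      using g realization_insert_edge[of x y "set (y # zs)"]
      by (simp add: path_image_join path_image_def[of "edge_path x y"])
    ultimately show ?thesis
      using g False by (intro exI[of _ "edge_path x y +++ g"]) simp
  qed
qed auto

text \<open>The closing edge meets the arc of the path only in its two ends, so the joined path is
  simple and closed.\<close>

lemma realization_cycle_homeomorphic_circle:
  assumes "distinct xs" "length xs \<ge> 3"
  shows "realization (set xs, cycle_edges xs) homeomorphic circle"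
proof -
  have ne: "hd xs \<noteq> last xs" "xs \<noteq> []"
    using hd_neq_last[OF assms(1)] assms(2) by auto
  obtain g where g: "arc g" "pathstart g = axis (hd xs) 1" "pathfinish g = axis (last xs) 1"
      "path_image g = realization (set xs, path_edges xs)"
    using realization_path_arc[OF assms(1)] assms(2) by auto
  let ?e = "edge_path (last xs) (hd xs)"
  have "path_image g \<inter> path_image ?e \<subseteq> {axis (hd xs) 1, axis (last xs) 1}"
  proof
    fix z assume "z \<in> path_image g \<inter> path_image ?e"
    then obtain t where t: "t \<in> {0..1}" "z = ?e t" and z: "z \<in> realization (set xs, path_edges xs)"
      using g(4) by (auto simp: path_image_def)
    have "t \<notin> {0<..<1}"
      using edge_path_in_realization_iff[OF simple_graph_path[OF assms(1)] ne(1)[symmetric], of t] z t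
        closing_edge_notin_path_edges[OF assms] by (auto simp: insert_commute)
    then have "t = 0 \<or> t = 1"
      using t by auto
    then show "z \<in> {axis (hd xs) 1, axis (last xs) 1}"
      using t by auto
  qed
  then have "simple_path (g +++ ?e)"
    using g ne by (intro simple_path_join_loop arc_edge_path) auto
  then have "path_image (g +++ ?e) homeomorphic (sphere 0 1 :: complex set)"
    using g by (intro homeomorphic_simple_path_image_circle) auto
  also have "(sphere 0 1 :: complex set) homeomorphic circle"
    by (rule homeomorphic_spheres_gen) auto
  also have "path_image (g +++ ?e) = realization (set xs, cycle_edges xs)"
  proof -
    have "insert (last xs) (insert (hd xs) (set xs)) = set xs"
      using ne by auto
    then have "realization (set xs, cycle_edges xs) = ?e ` {0..1} \<union> realization (set xs, path_edges xs)"
      using realization_insert_edge[of "last xs" "hd xs" "set xs" "path_edges xs"]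
      by (simp add: cycle_edges_def insert_commute)
    then show ?thesis
      using g by (simp add: path_image_join path_image_def[of ?e] Un_commute)
  qed
  finally show ?thesis .
qed

section \<open>Cycles as vertex lists\<close>

text \<open>If \<open>v\<close> had at most one edge, at most one point of the space would have
  \<open>v\<close>-coordinate 1/2, although this coordinate is 1 at \<open>v\<close> and 0 at any
  other vertex. This contradicts \<open>level_set_of_circle\<close>.\<close>

lemma circle_min_degree:
  assumes H: "simple_graph H" and circ: "realization H homeomorphic circle" and v: "v \<in> fst H"
  shows "\<exists>a b. a \<noteq> b \<and> {v, a} \<in> snd H \<and> {v, b} \<in> snd H"
proof (rule ccontr)
  assume "\<not> ?thesis"
  then have uniq: "\<And>a b. {v, a} \<in> snd H \<Longrightarrow> {v, b} \<in> snd H \<Longrightarrow> a = b"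
    by blast
  \<comment> \<open>If \<open>v\<close> has no edge, \<open>SOME\<close> returns an arbitrary
    vertex; the level set is then empty and the inclusion below still holds.\<close>
  define p where "p = edge_path v (SOME a. {v, a} \<in> snd H) (1 / 2)"
  have lev: "{z \<in> realization H. 1 - z $ v = 1 / 2} \<subseteq> {p}"
  proof safe
    fix z assume z: "z \<in> realization H" and eq: "1 - z $ v = 1 / 2"
    from H z show "z = p"
    proof (cases rule: realization_cases[consumes 2, case_names 1 2])
      case (1 w)
      then show ?thesis using eq by (auto simp: axis_def split: if_splits)
    next
      case (2 a b t)
      have "(v = a \<or> v = b) \<and> t = 1 / 2"
        using eq 2 by (auto simp: edge_path_nth split: if_splits)
      then obtain c where c: "{v, c} \<in> snd H" "z = edge_path v c (1 / 2)"
      proof -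
        have "edge_path a b (1 / 2) = edge_path b a (1 / 2)"
          by (simp add: vec_eq_iff edge_path_nth)
        then show ?thesis
          using that[of a] that[of b] 2 \<open>(v = a \<or> v = b) \<and> t = 1 / 2\<close> by (metis insert_commute)
      qed
      have "(SOME a. {v, a} \<in> snd H) = c"
        by (rule some_equality) (use c(1) uniq in blast)+
      then show ?thesis
        using c by (simp add: p_def)
    qed
  qed
  have "axis v 1 \<in> realization H"
    using v axis_in_realization_iff[OF H] by blast
  \<comment> \<open>Without a second vertex there is no edge either, and the space would have at
    most one point.\<close>
  moreover have "\<exists>w\<in>fst H. w \<noteq> v"
  proof (rule ccontr)
    assume "\<not> ?thesis"
    then have "w = v" if "w \<in> fst H" for w
      using that by blast
    then have "snd H = {}"
      using H by (metis ex_in_conv simple_graph_edge)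
    then have "realization H \<subseteq> {axis v 1}"
      using \<open>\<not> (\<exists>w\<in>fst H. w \<noteq> v)\<close> by (auto simp: realization_def)
    then have sing: "x = y" if "x \<in> realization H" "y \<in> realization H" for x y
      using that by blast
    obtain f g where fg: "homeomorphism (realization H) circle f g"
      using circ unfolding homeomorphic_def by blast
    obtain x y where xy: "x \<in> circle" "y \<in> circle" "x \<noteq> y"
      using circle_avoids_two_points by metis
    then have "g x \<in> realization H" "g y \<in> realization H" "f (g x) = x" "f (g y) = y"
      using fg by (auto simp: homeomorphism_def)
    then show False
      using sing xy(3) by metis
  qed
  then obtain w where "w \<in> fst H" "w \<noteq> v" by blast
  then have "axis w 1 \<in> realization H" "1 - axis w 1 $ v = (1::real)"
    using axis_in_realization_iff[OF H] by (auto simp: axis_def)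
  ultimately have "1 - axis w 1 $ v \<le> (1 / 2 :: real)"
    by (intro level_set_of_circle[OF circ _ lev]) (auto intro!: continuous_intros)
  then show False
    using \<open>1 - axis w 1 $ v = (1::real)\<close> by simp
qed

lemma path_edges_append: "path_edges (xs @ [y] @ ys) = path_edges (xs @ [y]) \<union> path_edges (y # ys)"
  by (induction xs rule: path_edges.induct) auto

text \<open>All neighbours of the first vertex of a longest path lie on the path. One of two
  neighbours is not the second vertex, and closing the path there gives at least three
  vertices.\<close>

lemma min_degree_cycle:
  fixes H :: "'v::finite graph"
  assumes H: "simple_graph H" and ne: "fst H \<noteq> {}"
    and deg: "\<And>v. v \<in> fst H \<Longrightarrow> \<exists>a b. a \<noteq> b \<and> {v, a} \<in> snd H \<and> {v, b} \<in> snd H"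
  shows "\<exists>xs. distinct xs \<and> length xs \<ge> 3 \<and> set xs \<subseteq> fst H \<and> cycle_edges xs \<subseteq> snd H"
proof -
  define P where "P = (\<lambda>xs. distinct xs \<and> xs \<noteq> [] \<and> set xs \<subseteq> fst H \<and> path_edges xs \<subseteq> snd H)"
  obtain v where "v \<in> fst H"
    using ne by blast
  then have "P [v]"
    by (simp add: P_def)
  moreover have "length xs < Suc CARD('v)" if "P xs" for xs
  proof -
    have "card (set xs) \<le> CARD('v)"
      by (intro card_mono) auto
    then show ?thesis
      using that by (simp add: P_def distinct_card)
  qed
  ultimately obtain xs where xs: "P xs" and max: "\<And>ys. P ys \<Longrightarrow> length ys \<le> length xs"
    using ex_has_greatest_nat[of P "[v]" length "Suc CARD('v)"] by blast
  obtain x r where r: "xs = x # r"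
    using xs by (cases xs) (auto simp: P_def)
  have nb: "a \<in> set r" if "{x, a} \<in> snd H" for a
  proof -
    have "a \<noteq> x" "a \<in> fst H"
      using simple_graph_edgeD[OF H that] by auto
    moreover have "\<not> P (a # xs)"
      using max by force
    ultimately show ?thesis
      using xs r that by (auto simp: P_def insert_commute)
  qed
  obtain a b where ab: "a \<noteq> b" "{x, a} \<in> snd H" "{x, b} \<in> snd H"
    using deg[of x] xs r by (auto simp: P_def)
  then obtain c where c: "c \<noteq> hd r" "{x, c} \<in> snd H"
    by metis
  then obtain r1 r2 where r12: "r = r1 @ c # r2"
    using nb by (meson split_list)
  have "r1 \<noteq> []"
    using c r12 by auto
  let ?ys = "x # r1 @ [c]"
  have "path_edges ?ys \<subseteq> path_edges xs"
    using r r12 path_edges_append[of "x # r1" c r2] by auto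
  then have "distinct ?ys \<and> length ?ys \<ge> 3 \<and> set ?ys \<subseteq> fst H \<and> cycle_edges ?ys \<subseteq> snd H"
    using xs r r12 c \<open>r1 \<noteq> []\<close> by (auto simp: P_def cycle_edges_def Suc_le_eq)
  then show ?thesis by blast
qed

text \<open>A graph whose space is a circle has minimum degree 2 and so contains a combinatorial
  cycle. The space of that cycle is a circle inside a circle, hence all of it, and the two graphs
  agree.\<close>

lemma cycles_eq:
  fixes G :: "'v::finite graph"
  assumes G: "simple_graph G"
  shows "cycles k G = {(set xs, cycle_edges xs) | xs. distinct xs \<and> length xs = k \<and> k \<ge> 3 \<and>
     set xs \<subseteq> fst G \<and> cycle_edges xs \<subseteq> snd G}"
proof safe
  fix V E assume VE: "(V, E) \<in> cycles k G"
  let ?H = "(V, E)"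
  have sub: "subgraph ?H G" and card: "card E = k" and circ: "realization ?H homeomorphic circle"
    using VE by (auto simp: cycles_def)
  have H: "simple_graph ?H"
    by (rule simple_graph_subgraph[OF sub G])
  have "realization ?H \<noteq> {}"
    using circ homeomorphic_empty(2) circle_avoids_two_points by (metis empty_iff)
  then have "V \<noteq> {}"
    using H by (metis ex_in_conv fst_conv realization_cases simple_graph_edgeD(2))
  then obtain xs where xs: "distinct xs" "length xs \<ge> 3" "set xs \<subseteq> V" "cycle_edges xs \<subseteq> E"
    using min_degree_cycle[OF H] circle_min_degree[OF H circ] by auto
  let ?C = "(set xs, cycle_edges xs)"
  have C: "simple_graph ?C"
    using xs by (intro simple_graph_cycle) auto
  have "realization ?C \<subseteq> realization ?H"
    using xs unfolding realization_def by auto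
  then have eq: "realization ?C = realization ?H"
    by (rule circle_subset_circle[OF realization_cycle_homeomorphic_circle[OF xs(1,2)] circ])
  have "V \<subseteq> set xs"
    using axis_in_realization_iff[OF H] axis_in_realization_iff[OF C] eq by auto
  moreover have "E \<subseteq> cycle_edges xs"
  proof
    fix e assume e: "e \<in> E"
    then obtain a b where ab: "e = {a, b}" "a \<noteq> b"
      using simple_graph_edge[OF H, of e] by (metis snd_conv)
    then show "e \<in> cycle_edges xs"
      using e edge_path_in_realization_iff[OF H ab(2), of "1 / 2"]
        edge_path_in_realization_iff[OF C ab(2), of "1 / 2"] eq by auto
  qed
  ultimately have "V = set xs" "E = cycle_edges xs"
    using xs by auto
  then show "\<exists>xs. (V, E) = (set xs, cycle_edges xs) \<and> distinct xs \<and> length xs = k \<and> k \<ge> 3 \<and>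
     set xs \<subseteq> fst G \<and> cycle_edges xs \<subseteq> snd G"
    using xs card card_cycle_edges[OF xs(1,2)] sub by (intro exI[of _ xs]) (auto simp: subgraph_def)
next
  fix xs :: "'v list"
  assume xs: "distinct xs" "k = length xs" "length xs \<ge> 3" "set xs \<subseteq> fst G" "cycle_edges xs \<subseteq> snd G"
  have "\<Union> (cycle_edges xs) \<subseteq> set xs"
    using simple_graph_cycle[OF xs(1)] xs(3) by (auto simp: simple_graph_def)
  then show "(set xs, cycle_edges xs) \<in> cycles (length xs) G"
    using xs card_cycle_edges[OF xs(1,3)] realization_cycle_homeomorphic_circle[OF xs(1,3)]
    by (simp add: cycles_def subgraph_def)
qed

section \<open>Normal form of a cycle relative to one of its edges\<close>

lemma path_edges_append_nonempty: "xs \<noteq> [] \<Longrightarrow> ys \<noteq> [] \<Longrightarrow>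
    path_edges (xs @ ys) = path_edges xs \<union> {{last xs, hd ys}} \<union> path_edges ys"
  by (induction xs rule: path_edges.induct) (auto simp: neq_Nil_conv)

lemma path_edges_rev: "path_edges (rev xs) = path_edges xs"
proof (induction xs rule: path_edges.induct)
  case (1 x y zs)
  have "path_edges (rev (x # y # zs)) = path_edges (rev (y # zs) @ [x])"
    by simp
  also have "\<dots> = path_edges (rev (y # zs)) \<union> {{last (rev (y # zs)), x}}"
    by (subst path_edges_append_nonempty) auto
  finally show ?case
    using 1 by (auto simp: insert_commute)
qed auto

lemma cycle_edges_rev: "xs \<noteq> [] \<Longrightarrow> cycle_edges (rev xs) = cycle_edges xs"
  by (simp add: cycle_edges_def path_edges_rev hd_rev last_rev insert_commute)

lemma cycle_edges_rotate: "xs \<noteq> [] \<Longrightarrow> ys \<noteq> [] \<Longrightarrow> cycle_edges (xs @ ys) = cycle_edges (ys @ xs)"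
  by (auto simp: cycle_edges_def path_edges_append_nonempty insert_commute)

lemma path_edges_decomp:
  assumes "e \<in> path_edges xs"
  obtains ys x y zs where "xs = ys @ x # y # zs" "e = {x, y}"
proof -
  have "\<exists>ys x y zs. xs = ys @ x # y # zs \<and> e = {x, y}"
    using assms
  proof (induction xs rule: path_edges.induct)
    case (1 x y zs)
    show ?case
    proof (cases "e = {x, y}")
      case True
      then show ?thesis by (metis append_Nil)
    next
      case False
      then obtain ys x' y' zs' where "y # zs = ys @ x' # y' # zs' \<and> e = {x', y'}"
        using 1 by auto
      then show ?thesis by (metis append_Cons)
    qed
  qed auto
  then show ?thesis
    using that by blast
qed

text \<open>Rotation makes the edge the closing one, and a reversal corrects its direction if
  necessary.\<close>

lemma cycle_through_edge:
  assumes "distinct xs" "length xs \<ge> 3" "{a, b} \<in> cycle_edges xs" "a \<noteq> b"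
  obtains ys where "distinct ys" "length ys = length xs" "set ys = set xs"
    "cycle_edges ys = cycle_edges xs" "hd ys = a" "last ys = b"
proof -
  have "\<exists>ys. distinct ys \<and> length ys = length xs \<and> set ys = set xs \<and>
      cycle_edges ys = cycle_edges xs \<and> {a, b} = {hd ys, last ys}"
  proof (cases "{a, b} = {hd xs, last xs}")
    case False
    then have "{a, b} \<in> path_edges xs"
      using assms(3) by (simp add: cycle_edges_def)
    then obtain us x y vs where xs: "xs = us @ x # y # vs" "{a, b} = {x, y}"
      by (rule path_edges_decomp)
    have "cycle_edges ((y # vs) @ (us @ [x])) = cycle_edges xs"
      using cycle_edges_rotate[of "us @ [x]" "y # vs"] xs by simp
    then show ?thesis
      using xs assms(1) by (intro exI[of _ "(y # vs) @ (us @ [x])"]) (auto simp: insert_commute)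
  qed (use assms in blast)
  then obtain ys where ys: "distinct ys" "length ys = length xs" "set ys = set xs"
      "cycle_edges ys = cycle_edges xs" "{a, b} = {hd ys, last ys}"
    by blast
  have "ys \<noteq> []"
    using ys(2) assms(2) by auto
  from ys(5) consider "hd ys = a" "last ys = b" | "hd ys = b" "last ys = a"
    using assms(4) by (auto simp: doubleton_eq_iff)
  then show ?thesis
  proof cases
    case 1
    then show ?thesis using that ys by blast
  next
    case 2
    then show ?thesis
      using ys \<open>ys \<noteq> []\<close> by (intro that[of "rev ys"]) (auto simp: cycle_edges_rev hd_rev last_rev)
  qed
qed

text \<open>The first vertex lies on a single path edge, which fixes the second vertex; removing
  that edge leaves a shorter path.\<close>

lemma path_determined_by_edges:
  assumes "distinct xs" "distinct ys" "xs \<noteq> []" "ys \<noteq> []" "hd xs = hd ys" "path_edges xs = path_edges ys"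
  shows "xs = ys"
  using assms
proof (induction xs arbitrary: ys rule: path_edges.induct)
  case (1 x y zs)
  obtain y' zs' where ys: "ys = x # y' # zs'"
    using 1(4-7) by (cases ys; cases "tl ys") auto
  have nin: "{x, w} \<notin> path_edges (y # zs)" "{x, w} \<notin> path_edges (y' # zs')" for w
    using path_edges_subset[of "{x, w}" "y # zs"] path_edges_subset[of "{x, w}" "y' # zs'"]
      1(2,3) ys by auto
  have eq: "insert {x, y} (path_edges (y # zs)) = insert {x, y'} (path_edges (y' # zs'))"
    using 1(7) ys by simp
  then have "y = y'"
    using nin by (metis doubleton_eq_iff insertI1 insertE)
  then have "path_edges (y # zs) = path_edges (y' # zs')"
    using eq nin by (metis insert_ident)
  then show ?case
    using 1(1)[of "y' # zs'"] 1(2,3) ys \<open>y = y'\<close> by simp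
next
  case ("2_2" v)
  then show ?case
    by (cases ys; cases "tl ys") auto
qed auto

text \<open>A prescribed closing edge with prescribed direction leaves no freedom to rotate or
  reverse, so each cycle is represented exactly once.\<close>

lemma cycles_through_edge:
  fixes G :: "'v::finite graph" and k :: nat
  assumes G: "simple_graph G" and ab: "{a, b} \<in> snd G"
  defines "P \<equiv> {xs. distinct xs \<and> length xs = k \<and> 3 \<le> k \<and> hd xs = a \<and> last xs = b \<and>
      set xs \<subseteq> fst G \<and> path_edges xs \<subseteq> snd G}"
  shows "bij_betw (\<lambda>xs. (set xs, cycle_edges xs)) P {\<gamma> \<in> cycles k G. {a, b} \<in> snd \<gamma>}"
proof (rule bij_betw_imageI)
  show "inj_on (\<lambda>xs. (set xs, cycle_edges xs)) P"
  proof (rule inj_onI)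
    fix xs ys assume xy: "xs \<in> P" "ys \<in> P" "(set xs, cycle_edges xs) = (set ys, cycle_edges ys)"
    then have xs: "distinct xs" "length xs \<ge> 3" "hd xs = a" "last xs = b" "xs \<noteq> []"
      and ys: "distinct ys" "length ys \<ge> 3" "hd ys = a" "last ys = b" "ys \<noteq> []"
      by (force simp: P_def)+
    have "{a, b} \<notin> path_edges xs" "{a, b} \<notin> path_edges ys"
      using closing_edge_notin_path_edges[OF xs(1,2)] closing_edge_notin_path_edges[OF ys(1,2)]
      unfolding xs(3,4) ys(3,4) by blast+
    moreover have "insert {a, b} (path_edges xs) = insert {a, b} (path_edges ys)"
      using xy(3) unfolding prod.inject cycle_edges_def xs(3,4) ys(3,4) by blast
    ultimately have "path_edges xs = path_edges ys"
      by (metis insert_ident)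
    then show "xs = ys"
      using xs ys by (intro path_determined_by_edges) simp_all
  qed
  show "(\<lambda>xs. (set xs, cycle_edges xs)) ` P = {\<gamma> \<in> cycles k G. {a, b} \<in> snd \<gamma>}"
  proof (intro subset_antisym subsetI)
    fix \<gamma> assume "\<gamma> \<in> (\<lambda>xs. (set xs, cycle_edges xs)) ` P"
    then obtain xs where xs: "xs \<in> P" "\<gamma> = (set xs, cycle_edges xs)"
      by blast
    then have "cycle_edges xs \<subseteq> snd G" "{a, b} \<in> cycle_edges xs"
      using ab by (auto simp: P_def cycle_edges_def)
    then show "\<gamma> \<in> {\<gamma> \<in> cycles k G. {a, b} \<in> snd \<gamma>}"
      using xs unfolding cycles_eq[OF G] P_def by auto
  next
    fix \<gamma> assume "\<gamma> \<in> {\<gamma> \<in> cycles k G. {a, b} \<in> snd \<gamma>}"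
    then obtain xs where xs: "\<gamma> = (set xs, cycle_edges xs)" "distinct xs" "length xs = k" "k \<ge> 3"
      "set xs \<subseteq> fst G" "cycle_edges xs \<subseteq> snd G" "{a, b} \<in> cycle_edges xs"
      unfolding cycles_eq[OF G] by auto
    have "a \<noteq> b"
      using simple_graph_edgeD[OF G ab] by blast
    then obtain ys where ys: "distinct ys" "length ys = length xs" "set ys = set xs"
      "cycle_edges ys = cycle_edges xs" "hd ys = a" "last ys = b"
      using cycle_through_edge[of xs a b] xs by blast
    moreover have "path_edges ys \<subseteq> snd G"
      using xs(6) unfolding ys(4)[symmetric] by (simp add: cycle_edges_def)
    ultimately have "ys \<in> P"
      using xs by (simp add: P_def)
    then show "\<gamma> \<in> (\<lambda>xs. (set xs, cycle_edges xs)) ` P"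
      using xs(1) ys(3,4) by (intro image_eqI[of _ _ ys]) simp_all
  qed
qed

section \<open>Enumeration of the paths between two vertices\<close>

fun all_paths :: "('a \<Rightarrow> 'a list) \<Rightarrow> nat \<Rightarrow> 'a list \<Rightarrow> 'a \<Rightarrow> 'a \<Rightarrow> 'a list list" where
  "all_paths nb 0 vs a b = []"
| "all_paths nb (Suc n) vs a b = (if a = b then [[a]] else
     map ((#) a) (concat (map (\<lambda>c. if c \<in> set (a # vs) then [] else all_paths nb n (a # vs) c b) (nb a))))"

text \<open>\<open>n\<close> bounds the number of vertices and \<open>vs\<close> collects the
  visited ones. The start is tested by the caller before the call, which is why only
  \<open>tl xs\<close> has to avoid \<open>vs\<close>.\<close>

lemma set_all_paths:
  "set (all_paths nb n vs a b) = {xs. xs \<noteq> [] \<and> hd xs = a \<and> last xs = b \<and> distinct xs \<and>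
     set (tl xs) \<inter> set vs = {} \<and> successively (\<lambda>x y. y \<in> set (nb x)) xs \<and> length xs \<le> n}"
proof (induction nb n vs a b rule: all_paths.induct)
  case (2 nb n vs a b)
  show ?case
  proof (cases "a = b")
    case True
    then have "xs = [a]" if "xs \<noteq> []" "hd xs = a" "last xs = b" "distinct xs" for xs
      using that by (cases xs) (auto split: if_splits)
    then show ?thesis
      using True by auto
  next
    case False
    note IH = 2[OF False]
    show ?thesis
    proof (intro subset_antisym subsetI)
      fix xs assume "xs \<in> set (all_paths nb (Suc n) vs a b)"
      then obtain c ys where c: "c \<in> set (nb a)" "c \<notin> set (a # vs)" "ys \<in> set (all_paths nb n (a # vs) c b)" "xs = a # ys"
        using False by (auto split: if_splits)
      from c(3)[unfolded IH[OF c(1,2)]] have "ys \<noteq> []" "hd ys = c" "last ys = b" "distinct ys" "set (tl ys) \<inter> set (a # vs) = {}"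
        "successively (\<lambda>x y. y \<in> set (nb x)) ys" "length ys \<le> n"
        by simp_all
      then show "xs \<in> {xs. xs \<noteq> [] \<and> hd xs = a \<and> last xs = b \<and> distinct xs \<and>
     set (tl xs) \<inter> set vs = {} \<and> successively (\<lambda>x y. y \<in> set (nb x)) xs \<and> length xs \<le> Suc n}"
        using c(1,2,4) by (cases ys) auto
    next
      fix xs assume xs: "xs \<in> {xs. xs \<noteq> [] \<and> hd xs = a \<and> last xs = b \<and> distinct xs \<and>
     set (tl xs) \<inter> set vs = {} \<and> successively (\<lambda>x y. y \<in> set (nb x)) xs \<and> length xs \<le> Suc n}"
      then obtain c ys where ys: "xs = a # c # ys"
        using False by (cases xs; cases "tl xs") auto
      have c: "c \<in> set (nb a)" "c \<notin> set (a # vs)"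
        using xs ys by auto
      have "c # ys \<in> set (all_paths nb n (a # vs) c b)"
        unfolding IH[OF c] using xs ys by auto
      then show "xs \<in> set (all_paths nb (Suc n) vs a b)"
        unfolding all_paths.simps ys using c False by simp blast
    qed
  qed
qed auto

lemma distinct_concat_map:
  assumes "distinct cs" "\<And>c. distinct (f c)" "\<And>c ys. ys \<in> set (f c) \<Longrightarrow> h ys = c"
  shows "distinct (concat (map f cs))"
  using assms(1)
proof (induction cs)
  case (Cons c cs)
  have "set (f c) \<inter> set (concat (map f cs)) = {}"
    using assms(3) Cons.prems by auto
  then show ?case
    using Cons assms(2) by simp
qed simp

text \<open>Cycles will be counted by lengths of lists, so repetitions have to be excluded. Lists
  coming from different neighbours differ in their heads.\<close>

lemma distinct_all_paths:
  assumes "\<And>x. distinct (nb x)"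
  shows "distinct (all_paths nb n vs a b)"
proof (induction n arbitrary: vs a)
  case (Suc n)
  let ?f = "\<lambda>c. if c \<in> set (a # vs) then [] else all_paths nb n (a # vs) c b"
  have hd: "hd ys = c" if "ys \<in> set (?f c)" for ys c
    using that by (auto simp: set_all_paths split: if_splits)
  have "distinct (concat (map ?f (nb a)))"
    by (rule distinct_concat_map[where h = hd]) (use assms Suc hd in auto)
  then show ?case
    using assms by (auto simp: distinct_map)
qed simp

fun uses_edge :: "'a \<times> 'a \<Rightarrow> 'a list \<Rightarrow> bool" where
  "uses_edge e (x # y # zs) = (e = (x, y) \<or> e = (y, x) \<or> uses_edge e (y # zs))"
| "uses_edge e _ = False"

lemma uses_edge_iff: "uses_edge e xs \<longleftrightarrow> {fst e, snd e} \<in> path_edges xs"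
  by (induction e xs rule: uses_edge.induct) (auto simp: doubleton_eq_iff)

definition of_length :: "nat \<Rightarrow> 'a list list \<Rightarrow> 'a list list" where
  "of_length k ps = filter (\<lambda>p. length p = k) ps"

text \<open>\<open>ps\<close> is meant to hold paths joining the ends of \<open>e\<close>, each
  standing for the cycle with closing edge \<open>e\<close>. The path itself does not use
  \<open>e\<close>, so \<open>e' = e\<close> is a separate case; it serves self-crossings of an
  edge.\<close>

definition path_count :: "'a \<times> 'a \<Rightarrow> 'a list list \<Rightarrow> 'a \<times> 'a \<Rightarrow> nat" where
  "path_count e ps e' = length (filter (\<lambda>p. e' = e \<or> uses_edge e' p) ps)"

text \<open>Automorphisms commute with the enumeration, even in the order of the list. Evaluation
  for one edge in each orbit is therefore enough.\<close>

lemma all_paths_map: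
  assumes "inj \<sigma>" "\<And>x. nb (\<sigma> x) = map \<sigma> (nb x)"
  shows "all_paths nb n (map \<sigma> vs) (\<sigma> a) (\<sigma> b) = map (map \<sigma>) (all_paths nb n vs a b)"
proof (induction n arbitrary: vs a)
  case (Suc n)
  define f where "f = (\<lambda>c. if c \<in> set (a # vs) then [] else all_paths nb n (a # vs) c b)"
  define g where "g = (\<lambda>c. if c \<in> set (\<sigma> a # map \<sigma> vs) then [] else
    all_paths nb n (\<sigma> a # map \<sigma> vs) c (\<sigma> b))"
  have gf: "g (\<sigma> c) = map (map \<sigma>) (f c)" for c
    using Suc[of "a # vs" c] assms(1) by (simp add: f_def g_def inj_image_mem_iff inj_eq)
  have "concat (map g (map \<sigma> (nb a))) = map (map \<sigma>) (concat (map f (nb a)))"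
    by (simp add: map_concat comp_def gf)
  then show ?case
    using assms unfolding all_paths.simps f_def[symmetric] g_def[symmetric] by (simp add: inj_eq)
qed simp

lemma uses_edge_map: "inj \<sigma> \<Longrightarrow> uses_edge (map_prod \<sigma> \<sigma> e) (map \<sigma> xs) = uses_edge e xs"
  by (induction e xs rule: uses_edge.induct) (auto simp: inj_eq)

lemma of_length_map: "of_length k (map (map \<sigma>) ps) = map (map \<sigma>) (of_length k ps)"
  by (simp add: of_length_def filter_map comp_def)

lemma path_count_map:
  assumes "inj \<sigma>"
  shows "path_count (map_prod \<sigma> \<sigma> e) (map (map \<sigma>) ps) (map_prod \<sigma> \<sigma> e') = path_count e ps e'"
  using assms prod.inj_map[OF assms assms]
  by (simp add: path_count_def filter_map comp_def uses_edge_map inj_eq)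

section \<open>Cycle counts in the Heawood graph\<close>

text \<open>
  For the computations the vertices \<open>u\<^sub>i\<close> and \<open>v\<^sub>i\<close> are coded as the integers \<open>i\<close> and \<open>7 + i\<close>
  (see \<open>hw_vertex\<close> below).
\<close>

definition hw_nb :: "int \<Rightarrow> int list" where
  "hw_nb a = (case map_of
     [(0, [7, 13, 9]), (1, [8, 7, 10]), (2, [9, 8, 11]), (3, [10, 9, 12]), (4, [11, 10, 13]),
      (5, [12, 11, 7]), (6, [13, 12, 8]),
      (7, [0, 1, 5]), (8, [1, 2, 6]), (9, [2, 3, 0]), (10, [3, 4, 1]), (11, [4, 5, 2]),
      (12, [5, 6, 3]), (13, [6, 0, 4])] a of Some l \<Rightarrow> l | None \<Rightarrow> [])"

definition hw_edges :: "(int \<times> int) list" where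
  "hw_edges = concat (map (\<lambda>a. map (Pair a) (hw_nb a)) [0, 1, 2, 3, 4, 5, 6])"

text \<open>First components are u-vertices, second ones v-vertices. A shared v-vertex is excluded
  as well, being a neighbour of the other u-vertex. Any two u-vertices have a common neighbour, so
  the distance is exactly 2.\<close>

definition hw_dist2 :: "int \<times> int \<Rightarrow> int \<times> int \<Rightarrow> bool" where
  "hw_dist2 x y \<longleftrightarrow> fst x \<noteq> fst y \<and> snd y \<notin> set (hw_nb (fst x)) \<and> snd x \<notin> set (hw_nb (fst y))"

text \<open>The automorphism \<open>i \<mapsto> i + 1\<close>, under which the edges form three orbits.\<close>

definition hw_shift :: "int \<Rightarrow> int" where
  "hw_shift a = (if a = 6 then 0 else if a = 13 then 7 else if 0 \<le> a \<and> a < 13 then a + 1 else a)"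

text \<open>14 is the number of all vertices, so a single enumeration serves all cycle
  lengths.\<close>

definition hw_paths :: "int \<times> int \<Rightarrow> int list list" where
  "hw_paths e = all_paths hw_nb 14 [] (fst e) (snd e)"

definition odd_at_dist2 :: "int \<times> int \<Rightarrow> int list list \<Rightarrow> bool" where
  "odd_at_dist2 e ps \<longleftrightarrow> (\<forall>e'\<in>set hw_edges. odd (path_count e ps e') = hw_dist2 e e')"

definition count_dvd :: "nat \<Rightarrow> int \<times> int \<Rightarrow> int list list \<Rightarrow> bool" where
  "count_dvd m e ps \<longleftrightarrow> (\<forall>e'\<in>set hw_edges. path_count e ps e' mod m = 0)"

definition hw_counts_ok :: "int \<times> int \<Rightarrow> int list list \<Rightarrow> bool" where
  "hw_counts_ok e ps \<longleftrightarrow> odd_at_dist2 e (of_length 6 ps) \<and> odd_at_dist2 e (of_length 8 ps) \<and>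
     odd_at_dist2 e (of_length 10 ps) \<and> count_dvd 4 e (of_length 12 ps) \<and> count_dvd 2 e (of_length 14 ps)"

definition hw_parities :: "int \<times> int \<Rightarrow> bool" where
  "hw_parities e \<longleftrightarrow> hw_counts_ok e (hw_paths e)"

lemma inj_hw_shift: "inj hw_shift"
  by (rule injI) (auto simp: hw_shift_def split: if_splits)

text \<open>Outside the codes 0 to 13 the list is empty and the shift is the identity, so the
  equation holds for every integer, as \<open>all_paths_map\<close> demands.\<close>

lemma hw_nb_shift: "hw_nb (hw_shift a) = map hw_shift (hw_nb a)"
proof (cases "a \<in> {0, 1, 2, 3, 4, 5, 6, 7, 8, 9, 10, 11, 12, 13}")
  case True
  then show ?thesis
    by (auto simp: hw_nb_def hw_shift_def)
next
  case False
  then have "hw_nb a = []"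
    by (simp add: hw_nb_def)
  moreover have "a < 0 \<or> a > 13"
    using False by simp presburger
  then have "hw_shift a = a"
    by (auto simp: hw_shift_def)
  ultimately show ?thesis
    by simp
qed

lemma set_hw_edges_shift: "set hw_edges = map_prod hw_shift hw_shift ` set hw_edges"
  by code_simp

lemma hw_dist2_shift: "hw_dist2 (map_prod hw_shift hw_shift x) (map_prod hw_shift hw_shift y) = hw_dist2 x y"
  using inj_hw_shift by (auto simp: hw_dist2_def hw_nb_shift inj_eq inj_image_mem_iff)

lemma hw_paths_shift: "hw_paths (map_prod hw_shift hw_shift e) = map (map hw_shift) (hw_paths e)"
  unfolding hw_paths_def
  using all_paths_map[where nb = hw_nb, OF inj_hw_shift hw_nb_shift, of 14 "[]" "fst e" "snd e"]
  by (simp only: list.map fst_map_prod snd_map_prod)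

lemma odd_at_dist2_shift:
  "odd_at_dist2 e ps \<Longrightarrow> odd_at_dist2 (map_prod hw_shift hw_shift e) (map (map hw_shift) ps)"
  unfolding odd_at_dist2_def
  by (subst set_hw_edges_shift) (simp add: path_count_map[OF inj_hw_shift] hw_dist2_shift)

lemma count_dvd_shift:
  "count_dvd m e ps \<Longrightarrow> count_dvd m (map_prod hw_shift hw_shift e) (map (map hw_shift) ps)"
  unfolding count_dvd_def
  by (subst set_hw_edges_shift) (simp add: path_count_map[OF inj_hw_shift])

lemma hw_parities_shift: "hw_parities e \<Longrightarrow> hw_parities (map_prod hw_shift hw_shift e)"
  unfolding hw_parities_def hw_counts_ok_def
  by (simp add: hw_paths_shift of_length_map odd_at_dist2_shift count_dvd_shift)

section \<open>Finite checks on the pairs of edges at distance 2\<close>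

definition hw_pairs :: "((int \<times> int) \<times> (int \<times> int)) list" where
  "hw_pairs = filter (\<lambda>(x, y). hw_dist2 x y \<and> fst x < fst y) (List.product hw_edges hw_edges)"

definition hw_dist2_ends :: "int \<times> int \<Rightarrow> int list" where
  "hw_dist2_ends y = concat (map (\<lambda>x. [fst x, snd x]) (filter (\<lambda>x. hw_dist2 x y) hw_edges))"

definition hw_sign :: "int \<Rightarrow> int \<Rightarrow> int" where
  "hw_sign x y = (if x < y then 1 else -1)"

text \<open>
  The part of the winding number along the boundary of the square that comes from comparing the
  chosen arguments of opposite directions.
\<close>

definition hw_sign_sum :: "(int \<times> int) \<times> (int \<times> int) \<Rightarrow> int" where
  "hw_sign_sum t = (case t of ((a, b), (c, d)) \<Rightarrow>
     (hw_sign b c + hw_sign d b + hw_sign a d + hw_sign c a) div 2)"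

text \<open>For a pair \<open>((a, b), (c, d))\<close> in \<open>hw_pairs\<close>,
  \<open>a < c\<close> are codes of u-vertices and \<open>b\<close>, \<open>d\<close> codes of
  v-vertices, so \<open>hw_sign_sum\<close> is -1 if \<open>b < d\<close> and 0 if
  \<open>d < b\<close>. It is odd exactly when the chords ab and cd cross after placing the vertices
  on a convex curve in the order of their codes: the obstruction is evaluated on this
  drawing.\<close>

lemma hw_sign_sum_odd: "odd (sum_list (map hw_sign_sum hw_pairs))"
  by code_simp

definition all_twice :: "int list \<Rightarrow> bool" where
  "all_twice xs \<longleftrightarrow> (\<forall>x\<in>set xs. count_list xs x = 2)"

text \<open>This is the mod 2 cycle condition. For an edge uv, a u-vertex not adjacent to v shares
  exactly one neighbour with u, and its other two neighbours give its two edges at distance 2; the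
  same holds for v-vertices.\<close>

lemma hw_dist2_ends_twice: "\<forall>y\<in>set hw_edges. all_twice (hw_dist2_ends y)"
  by code_simp

lemma hw_parities_0_7: "hw_parities (0, 7)"
  by code_simp

lemma hw_parities_0_13: "hw_parities (0, 13)"
  by code_simp

lemma hw_parities_0_9: "hw_parities (0, 9)"
  by code_simp

text \<open>The representatives are u_0 v_0, u_0 v_6 and u_0 v_2, one for each of the three kinds of
  edges in the definition of the graph.\<close>

lemma hw_edges_orbit: "set hw_edges = (\<Union>n\<in>set [0..<7]. (map_prod hw_shift hw_shift ^^ n) ` set [(0, 7), (0, 13), (0, 9)])"
  by code_simp

lemma hw_parities:
  assumes "e \<in> set hw_edges"
  shows "hw_parities e"
proof -
  obtain n e0 where e: "e = (map_prod hw_shift hw_shift ^^ n) e0" "e0 \<in> set [(0, 7), (0, 13), (0, 9)]"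
    using assms unfolding hw_edges_orbit by blast
  have "hw_parities ((map_prod hw_shift hw_shift ^^ n) e0)"
    using e(2) hw_parities_0_7 hw_parities_0_13 hw_parities_0_9 by (induction n) (auto intro: hw_parities_shift)
  then show ?thesis
    using e by simp
qed

section \<open>From integer codes to the vertices of the graph\<close>

definition hw_vertex :: "int \<Rightarrow> 7 + 7" where
  "hw_vertex n = (if n < 7 then Inl (of_int n) else Inr (of_int (n - 7)))"

definition hw_edge :: "int \<times> int \<Rightarrow> (7 + 7) set" where
  "hw_edge e = {hw_vertex (fst e), hw_vertex (snd e)}"

lemma of_int_mod7_inject:
  assumes "x \<in> {0..6}" "y \<in> {0..6}" "(of_int x :: 7) = of_int y"
  shows "x = y"
proof -
  have "x \<in> {0, 1, 2, 3, 4, 5, 6}" "y \<in> {0, 1, 2, 3, 4, 5, 6}"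
    using assms(1,2) by (simp, presburger)+
  then show ?thesis
    using assms(3) by auto
qed

lemma inj_on_hw_vertex: "inj_on hw_vertex {0..13}"
proof (rule inj_onI)
  fix x y assume xy: "x \<in> {0..13}" "y \<in> {0..13}" "hw_vertex x = hw_vertex y"
  then consider "x < 7" "y < 7" "(of_int x :: 7) = of_int y" | "x \<ge> 7" "y \<ge> 7" "(of_int (x - 7) :: 7) = of_int (y - 7)"
    by (auto simp: hw_vertex_def split: if_splits)
  then show "x = y"
    using of_int_mod7_inject[of x y] of_int_mod7_inject[of "x - 7" "y - 7"] xy by cases auto
qed

lemma exists_of_int_mod7: "\<exists>n\<in>{0..6}. (i :: 7) = of_int n"
  by (cases i rule: bit1_cases) auto

lemma hw_vertex_image: "hw_vertex ` {0..13} = UNIV"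
proof -
  have "v \<in> hw_vertex ` {0..13}" for v
  proof (cases v)
    case (Inl i)
    then obtain n where "n \<in> {0..6}" "v = Inl (of_int n)"
      using exists_of_int_mod7 by blast
    then show ?thesis
      by (intro image_eqI[of _ _ n]) (auto simp: hw_vertex_def)
  next
    case (Inr i)
    then obtain n where "n \<in> {0..6}" "v = Inr (of_int n)"
      using exists_of_int_mod7 by blast
    then show ?thesis
      by (intro image_eqI[of _ _ "n + 7"]) (auto simp: hw_vertex_def)
  qed
  then show ?thesis by blast
qed

lemma UNIV_7: "(UNIV :: 7 set) = {0, 1, 2, 3, 4, 5, 6}"
proof -
  have "i \<in> {0, 1, 2, 3, 4, 5, 6}" for i :: 7
  proof -
    obtain n where n: "n \<in> {0..6}" "i = of_int n"
      using exists_of_int_mod7 by blast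
    then have "n \<in> {0, 1, 2, 3, 4, 5, 6}"
      by (simp, presburger)
    then show ?thesis
      using n(2) by auto
  qed
  then show ?thesis by blast
qed

lemma set_hw_edges: "set hw_edges = {(0, 7), (0, 13), (0, 9), (1, 8), (1, 7), (1, 10), (2, 9), (2, 8), (2, 11),
   (3, 10), (3, 9), (3, 12), (4, 11), (4, 10), (4, 13), (5, 12), (5, 11), (5, 7), (6, 13), (6, 12), (6, 8)}"
  by code_simp

lemma heawood_edges: "snd heawood_graph = hw_edge ` set hw_edges"
proof -
  have neg: "(-1 :: 7) = 6" "(-2 :: 7) = 5"
    by simp_all
  show ?thesis
    unfolding set_hw_edges heawood_graph_def UNIV_7
    by (simp add: hw_edge_def hw_vertex_def neg insert_commute)
qed

lemma fst_heawood_graph: "fst heawood_graph = UNIV"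
  by (simp add: heawood_graph_def)

lemma simple_heawood_graph: "simple_graph heawood_graph"
  by (auto simp: simple_graph_def heawood_graph_def)

lemma hw_edges_range: "e \<in> set hw_edges \<Longrightarrow> fst e \<in> {0..6} \<and> snd e \<in> {7..13}"
  by (auto simp: set_hw_edges)

lemma hw_nb_range:
  assumes "y \<in> set (hw_nb x)"
  shows "y \<in> {0..13}"
proof -
  have "x \<in> {0, 1, 2, 3, 4, 5, 6, 7, 8, 9, 10, 11, 12, 13}"
  proof (rule ccontr)
    assume "\<not> ?thesis"
    then have "hw_nb x = []"
      by (simp add: hw_nb_def)
    then show False
      using assms by simp
  qed
  then have "x \<in> set [0..13]"
    by auto
  moreover have "\<forall>x\<in>set [0..13]. \<forall>y\<in>set (hw_nb x). 0 \<le> y \<and> y \<le> 13"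
    by code_simp
  ultimately have "0 \<le> y \<and> y \<le> 13"
    using assms by blast
  then show ?thesis
    by simp
qed

lemma hw_nb_iff:
  assumes "x \<in> {0..13}" "y \<in> {0..13}"
  shows "y \<in> set (hw_nb x) \<longleftrightarrow> (x, y) \<in> set hw_edges \<or> (y, x) \<in> set hw_edges"
proof -
  have "\<forall>x\<in>set [0..13]. \<forall>y\<in>set [0..13]. (y \<in> set (hw_nb x)) = ((x, y) \<in> set hw_edges \<or> (y, x) \<in> set hw_edges)"
    by code_simp
  moreover have "x \<in> set [0..13]" "y \<in> set [0..13]"
    using assms by (simp_all only: set_upto)
  ultimately show ?thesis
    by blast
qed

lemma hw_edge_eq_iff:
  assumes "a \<in> {0..13}" "b \<in> {0..13}" "c \<in> {0..13}" "d \<in> {0..13}"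
  shows "{hw_vertex a, hw_vertex b} = {hw_vertex c, hw_vertex d} \<longleftrightarrow> {a, b} = {c, d}"
  using inj_on_image_eq_iff[OF inj_on_hw_vertex, of "{a, b}" "{c, d}"] assms by auto

lemma inj_on_hw_edge: "inj_on hw_edge (set hw_edges)"
proof (rule inj_onI)
  fix x y assume xy: "x \<in> set hw_edges" "y \<in> set hw_edges" "hw_edge x = hw_edge y"
  then have "{fst x, snd x} = {fst y, snd y}"
    using hw_edges_range[OF xy(1)] hw_edges_range[OF xy(2)] unfolding hw_edge_def
    by (subst (asm) hw_edge_eq_iff) auto
  then show "x = y"
    using hw_edges_range[OF xy(1)] hw_edges_range[OF xy(2)]
    by (auto simp: doubleton_eq_iff prod_eq_iff)
qed

lemma heawood_adjacent_iff:
  assumes "x \<in> {0..13}" "y \<in> {0..13}"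
  shows "{hw_vertex x, hw_vertex y} \<in> snd heawood_graph \<longleftrightarrow> y \<in> set (hw_nb x)"
proof -
  have "{hw_vertex x, hw_vertex y} = hw_edge e \<longleftrightarrow> e = (x, y) \<or> e = (y, x)" if "e \<in> set hw_edges" for e
    using hw_edges_range[OF that] assms unfolding hw_edge_def
    by (subst hw_edge_eq_iff) (auto simp: doubleton_eq_iff prod_eq_iff)
  then show ?thesis
    unfolding heawood_edges hw_nb_iff[OF assms] by blast
qed

lemma path_edges_map: "path_edges (map f xs) = (`) f ` path_edges xs"
  by (induction xs rule: path_edges.induct) auto

lemma heawood_path_iff:
  assumes "set xs \<subseteq> {0..13}"
  shows "path_edges (map hw_vertex xs) \<subseteq> snd heawood_graph \<longleftrightarrow> successively (\<lambda>x y. y \<in> set (hw_nb x)) xs"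
  using assms by (induction xs rule: path_edges.induct) (auto simp: heawood_adjacent_iff)

text \<open>Keeps enumerated paths inside the range of codes on which \<open>hw_vertex\<close> is
  injective.\<close>

lemma hw_path_range:
  assumes "successively (\<lambda>x y. y \<in> set (hw_nb x)) xs" "xs \<noteq> []" "hd xs \<in> {0..13}"
  shows "set xs \<subseteq> {0..13}"
  using assms
proof (induction xs rule: path_edges.induct)
  case (1 x y zs)
  then show ?case
    using hw_nb_range[of y x] by auto
qed auto

text \<open>Cycles through \<open>e\<close> are paths between its ends; \<open>hw_vertex\<close>
  translates these into the enumerated list, and the second edge becomes a filter on that
  list.\<close>

lemma card_cycles_through_edges:
  assumes e: "e \<in> set hw_edges" and e': "e' \<in> set hw_edges" and k: "3 \<le> k" "k \<le> 14"
  shows "card {\<gamma> \<in> cycles k heawood_graph. {hw_edge e, hw_edge e'} \<subseteq> snd \<gamma>} =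
    path_count e (of_length k (hw_paths e)) e'"
proof -
  obtain a b where ab: "e = (a, b)" "a \<in> {0..6}" "b \<in> {7..13}"
    using hw_edges_range[OF e] by (cases e) auto
  obtain c d where cd: "e' = (c, d)" "c \<in> {0..6}" "d \<in> {7..13}"
    using hw_edges_range[OF e'] by (cases e') auto
  let ?a = "hw_vertex a" and ?b = "hw_vertex b"
  define F where "F = (\<lambda>xs :: (7 + 7) list. (set xs, cycle_edges xs))"
  define P where "P = {xs. distinct xs \<and> length xs = k \<and> 3 \<le> k \<and> hd xs = ?a \<and> last xs = ?b \<and>
      set xs \<subseteq> fst heawood_graph \<and> path_edges xs \<subseteq> snd heawood_graph}"
  define L where "L = of_length k (hw_paths e)"
  have "{?a, ?b} \<in> snd heawood_graph"
    using e unfolding heawood_edges ab by (intro image_eqI[of _ _ "(a, b)"]) (simp_all add: hw_edge_def)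
  from cycles_through_edge[OF simple_heawood_graph this, of k]
  have bij: "bij_betw F P {\<gamma> \<in> cycles k heawood_graph. {?a, ?b} \<in> snd \<gamma>}"
    by (simp only: P_def F_def)
  \<comment> \<open>The length bound 14 in the enumeration loses nothing because
    \<open>k \<le> 14\<close>.\<close>
  have setL: "set L = {p. p \<noteq> [] \<and> hd p = a \<and> last p = b \<and> distinct p \<and>
      successively (\<lambda>x y. y \<in> set (hw_nb x)) p \<and> length p = k}"
    using k(2) by (auto simp: L_def of_length_def hw_paths_def set_all_paths ab)
  have rangeL: "set p \<subseteq> {0..13}" if "p \<in> set L" for p
    using hw_path_range[of p] that ab by (auto simp: setL)
  have injL: "inj_on (map hw_vertex) (set L)"
    using inj_on_subset[OF inj_on_hw_vertex] rangeL
    by (intro inj_on_mapI) (auto intro: inj_on_subset)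
  have P: "P = map hw_vertex ` set L"
  proof (intro subset_antisym subsetI)
    fix xs assume xs: "xs \<in> P"
    define p where "p = map (inv_into {0..13} hw_vertex) xs"
    have pr: "set p \<subseteq> {0..13}"
      unfolding p_def using inv_into_into[of _ hw_vertex "{0..13}"] hw_vertex_image by auto
    have mp: "map hw_vertex p = xs"
      unfolding p_def using f_inv_into_f[of _ hw_vertex "{0..13}"] hw_vertex_image
      by (simp add: comp_def)
    have ne: "p \<noteq> []"
      using xs mp k by (auto simp: P_def)
    have "hw_vertex (hd p) = ?a" "hw_vertex (last p) = ?b"
      using xs mp ne by (auto simp: P_def hd_map last_map)
    moreover have "hd p \<in> {0..13}" "last p \<in> {0..13}"
      using pr hd_in_set[OF ne] last_in_set[OF ne] by blast+
    ultimately have "hd p = a" "last p = b"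
      using inj_on_hw_vertex ab by (auto dest: inj_onD)
    moreover have "distinct p" "length p = k"
      using xs mp by (auto simp: P_def distinct_map)
    moreover have "successively (\<lambda>x y. y \<in> set (hw_nb x)) p"
      using heawood_path_iff[OF pr] xs mp by (simp add: P_def)
    ultimately show "xs \<in> map hw_vertex ` set L"
      using mp ne by (auto simp: setL)
  next
    fix xs assume "xs \<in> map hw_vertex ` set L"
    then obtain p where p: "p \<in> set L" "xs = map hw_vertex p"
      by blast
    note pr = rangeL[OF p(1)]
    have "distinct xs"
      using p pr inj_on_subset[OF inj_on_hw_vertex pr] by (simp add: setL distinct_map)
    then show "xs \<in> P"
      using p heawood_path_iff[OF pr] k by (auto simp: P_def setL hd_map last_map fst_heawood_graph)
  qed
  have uses: "hw_edge e' \<in> cycle_edges (map hw_vertex p) \<longleftrightarrow> e' = e \<or> uses_edge e' p" if p: "p \<in> set L" for p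
  proof -
    have "cycle_edges (map hw_vertex p) = insert (hw_edge e) ((`) hw_vertex ` path_edges p)"
      using p by (simp add: cycle_edges_def setL hd_map last_map hw_edge_def ab path_edges_map)
    moreover have "hw_edge e' = hw_edge e \<longleftrightarrow> e' = e"
      using inj_on_hw_edge e e' by (auto dest: inj_onD)
    moreover have "hw_edge e' \<in> (`) hw_vertex ` path_edges p \<longleftrightarrow> {fst e', snd e'} \<in> path_edges p"
    proof -
      have "hw_edge e' = hw_vertex ` S \<longleftrightarrow> {fst e', snd e'} = S" if "S \<in> path_edges p" for S
        using inj_on_image_eq_iff[OF inj_on_hw_vertex, of "{c, d}" S] cd rangeL[OF p]
          path_edges_subset[OF that] by (auto simp: hw_edge_def)
      then show ?thesis by blast
    qed
    ultimately show ?thesis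
      by (simp add: uses_edge_iff)
  qed
  define L' where "L' = filter (\<lambda>p. e' = e \<or> uses_edge e' p) L"
  have sub: "map hw_vertex ` set L' \<subseteq> P"
    unfolding P L'_def by auto
  have "{\<gamma> \<in> cycles k heawood_graph. {hw_edge e, hw_edge e'} \<subseteq> snd \<gamma>} =
      {\<gamma> \<in> {\<gamma> \<in> cycles k heawood_graph. {?a, ?b} \<in> snd \<gamma>}. hw_edge e' \<in> snd \<gamma>}"
    by (auto simp: hw_edge_def ab)
  also have "\<dots> = {\<gamma> \<in> F ` P. hw_edge e' \<in> snd \<gamma>}"
    using bij by (simp add: bij_betw_def)
  also have "\<dots> = F ` map hw_vertex ` set L'"
    using uses unfolding P by (auto simp: F_def L'_def)
  finally have "card {\<gamma> \<in> cycles k heawood_graph. {hw_edge e, hw_edge e'} \<subseteq> snd \<gamma>} = card (F ` map hw_vertex ` set L')"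
    by simp
  also have "\<dots> = card (map hw_vertex ` set L')"
    using bij sub by (intro card_image) (auto simp: bij_betw_def intro: inj_on_subset)
  also have "\<dots> = card (set L')"
    by (rule card_image[OF inj_on_subset[OF injL]]) (auto simp: L'_def)
  also have "\<dots> = length L'"
  proof (rule distinct_card)
    have "\<And>x. distinct (hw_nb x)"
      by (simp add: hw_nb_def)
    then show "distinct L'"
      by (simp add: L'_def L_def of_length_def hw_paths_def distinct_all_paths)
  qed
  finally show ?thesis
    by (simp add: L'_def L_def path_count_def)
qed

section \<open>Crossings of a generic immersion\<close>

text \<open>For an interior point of an edge this is the edge itself, for a vertex a
  singleton.\<close>

definition support :: "real ^ 'v \<Rightarrow> 'v set" where
  "support z = {v. z $ v \<noteq> 0}"

lemma support_edge_path: "a \<noteq> b \<Longrightarrow> s \<in> {0<..<1} \<Longrightarrow> support (edge_path a b s) = {a, b}"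
  by (auto simp: support_def edge_path_nth)

lemma edge_path_swap: "edge_path a b s = edge_path b a (1 - s)"
  by (simp add: vec_eq_iff edge_path_nth)

text \<open>A set rather than a pair: the two branches come in no order, and a self-crossing of an
  edge gives a singleton.\<close>

definition crossing_edges :: "'v::finite graph \<Rightarrow> (real ^ 'v \<Rightarrow> real ^ 2) \<Rightarrow> real ^ 2 \<Rightarrow> 'v set set" where
  "crossing_edges G f p = support ` {z \<in> realization G. f z = p}"

lemma multiple_point_cases:
  assumes "plane_generic_immersion G f" "p \<in> multiple_points f (realization G)"
  obtains x y where "x \<noteq> y" "{z \<in> realization G. f z = p} = {x, y}" "transversal_at G f x y"
proof -
  have "\<forall>p\<in>multiple_points f (realization G).
        \<exists>x y. x \<noteq> y \<and> {z \<in> realization G. f z = p} = {x, y} \<and> transversal_at G f x y"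
    using assms(1) unfolding plane_generic_immersion_def by (elim conjE)
  then show ?thesis
    using assms(2) that by blast
qed

lemma transversal_at_support:
  assumes "simple_graph G" "transversal_at G f x y"
  shows "support x \<in> snd G" "support y \<in> snd G"
    "simple_graph H \<Longrightarrow> x \<in> realization H \<longleftrightarrow> support x \<in> snd H"
    "simple_graph H \<Longrightarrow> y \<in> realization H \<longleftrightarrow> support y \<in> snd H"
proof -
  obtain a b c d s t where x: "{a, b} \<in> snd G" "0 < s" "s < 1" "x = edge_path a b s"
    and y: "{c, d} \<in> snd G" "0 < t" "t < 1" "y = edge_path c d t"
    using assms(2) unfolding transversal_at_def by blast
  have ne: "a \<noteq> b" "c \<noteq> d"
    using simple_graph_edgeD[OF assms(1)] x(1) y(1) by blast+
  have sup: "support x = {a, b}" "support y = {c, d}"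
    using x y ne by (auto simp: support_edge_path)
  show "support x \<in> snd G" "support y \<in> snd G"
    using sup x y by auto
  show "x \<in> realization H \<longleftrightarrow> support x \<in> snd H" if "simple_graph H"
    using edge_path_in_realization_iff[OF that ne(1), of s] x sup by simp
  show "y \<in> realization H \<longleftrightarrow> support y \<in> snd H" if "simple_graph H"
    using edge_path_in_realization_iff[OF that ne(2), of t] y sup by simp
qed

lemma realization_subgraph: "subgraph H G \<Longrightarrow> realization H \<subseteq> realization G"
  by (auto simp: realization_def subgraph_def)

lemma crossing_edges_cases:
  assumes "simple_graph G" "plane_generic_immersion G f" "p \<in> multiple_points f (realization G)"
  obtains e e' where "crossing_edges G f p = {e, e'}" "e \<in> snd G" "e' \<in> snd G"
proof -
  obtain x y where xy: "x \<noteq> y" "{z \<in> realization G. f z = p} = {x, y}" "transversal_at G f x y"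
    using multiple_point_cases[OF assms(2,3)] .
  show ?thesis
    using that[of "support x" "support y"] transversal_at_support(1,2)[OF assms(1) xy(3)] xy(2)
    by (simp add: crossing_edges_def)
qed

text \<open>A crossing survives restriction to \<open>H\<close> only if both preimages do. These are
  interior points of edges, so they lie in the space of \<open>H\<close> exactly when their edges
  belong to \<open>H\<close>.\<close>

lemma multiple_points_subgraph:
  assumes "simple_graph G" "plane_generic_immersion G f" "subgraph H G"
  shows "multiple_points f (realization H) =
    {p \<in> multiple_points f (realization G). crossing_edges G f p \<subseteq> snd H}"
proof -
  have H: "simple_graph H"
    by (rule simple_graph_subgraph[OF assms(3,1)])
  note sub = realization_subgraph[OF assms(3)]
  have "p \<in> multiple_points f (realization H) \<longleftrightarrow> crossing_edges G f p \<subseteq> snd H"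
    if p: "p \<in> multiple_points f (realization G)" for p
  proof -
    obtain x y where xy: "x \<noteq> y" "{z \<in> realization G. f z = p} = {x, y}" "transversal_at G f x y"
      using multiple_point_cases[OF assms(2) p] .
    have "p \<in> multiple_points f (realization H) \<longleftrightarrow> x \<in> realization H \<and> y \<in> realization H"
    proof
      assume "p \<in> multiple_points f (realization H)"
      then obtain u v where uv: "u \<in> realization H" "v \<in> realization H" "u \<noteq> v" "f u = p" "f v = p"
        by (auto simp: multiple_points_def)
      then have "u \<in> {x, y}" "v \<in> {x, y}"
        using sub xy(2) by blast+
      then show "x \<in> realization H \<and> y \<in> realization H"
        using uv by auto
    next
      assume "x \<in> realization H \<and> y \<in> realization H"
      moreover have "f x = p" "f y = p"
        using xy(2) by blast+
      ultimately show "p \<in> multiple_points f (realization H)"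
        using xy(1) by (auto simp: multiple_points_def)
    qed
    also have "\<dots> \<longleftrightarrow> crossing_edges G f p \<subseteq> snd H"
      using transversal_at_support(3,4)[OF assms(1) xy(3) H] xy(2) by (simp add: crossing_edges_def)
    finally show ?thesis .
  qed
  moreover have "multiple_points f (realization H) \<subseteq> multiple_points f (realization G)"
    using sub by (auto simp: multiple_points_def)
  ultimately show ?thesis by blast
qed

lemma sum_crossing_number:
  fixes G :: "'v::finite graph"
  assumes "simple_graph G" "plane_generic_immersion G f"
  shows "(\<Sum>\<gamma>\<in>cycles k G. crossing_number f \<gamma>) =
    (\<Sum>p\<in>multiple_points f (realization G). card {\<gamma> \<in> cycles k G. crossing_edges G f p \<subseteq> snd \<gamma>})"
proof -
  let ?M = "multiple_points f (realization G)"
  have fin: "finite ?M"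
    using assms(2) by (simp add: plane_generic_immersion_def)
  have "crossing_number f \<gamma> = (\<Sum>p\<in>?M. if crossing_edges G f p \<subseteq> snd \<gamma> then 1 else 0)"
    if "\<gamma> \<in> cycles k G" for \<gamma>
    using multiple_points_subgraph[OF assms, of \<gamma>] that fin
    by (simp add: crossing_number_def cycles_def sum.If_cases Collect_conj_eq)
  then have "(\<Sum>\<gamma>\<in>cycles k G. crossing_number f \<gamma>) =
      (\<Sum>\<gamma>\<in>cycles k G. \<Sum>p\<in>?M. if crossing_edges G f p \<subseteq> snd \<gamma> then 1 else 0)"
    by (rule sum.cong[OF refl])
  also have "\<dots> = (\<Sum>p\<in>?M. \<Sum>\<gamma>\<in>cycles k G. if crossing_edges G f p \<subseteq> snd \<gamma> then 1 else 0)"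
    by (rule sum.swap)
  also have "\<dots> = (\<Sum>p\<in>?M. card {\<gamma> \<in> cycles k G. crossing_edges G f p \<subseteq> snd \<gamma>})"
    by (simp add: sum.If_cases Collect_conj_eq)
  finally show ?thesis .
qed

section \<open>Tangent vectors and parameters of a crossing\<close>

definition plane_to_complex :: "real ^ 2 \<Rightarrow> complex" where
  "plane_to_complex z = Complex (z $ 1) (z $ 2)"

lemma bounded_linear_plane_to_complex: "bounded_linear plane_to_complex"
  unfolding linear_conv_bounded_linear[symmetric]
  by (rule linearI) (simp_all add: plane_to_complex_def complex_eq_iff)

lemma inj_plane_to_complex: "inj plane_to_complex"
  by (rule injI) (simp add: plane_to_complex_def vec_eq_iff forall_2)

text \<open>Dependent vectors lie in the span of one of them, which is too small for the plane. The
  conclusion has the form needed in \<open>crossing_parity\<close>.\<close>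

lemma spanning_pair_independent:
  fixes D E :: "real ^ 2"
  assumes "span {D, E} = UNIV" "u *\<^sub>R D = v *\<^sub>R E"
  shows "u = 0 \<and> v = 0"
proof (rule ccontr)
  assume "\<not> ?thesis"
  then consider "u \<noteq> 0" | "v \<noteq> 0" by blast
  then have "\<exists>w. span {D, E} \<subseteq> span {w}"
  proof cases
    case 1
    then have "D = (v / u) *\<^sub>R E"
      using arg_cong[OF assms(2), of "scaleR (1 / u)"] by simp
    then have "D \<in> span {E}"
      by (metis span_base span_scale singletonI)
    then show ?thesis
      by (intro exI[of _ E] span_minimal) (auto simp: span_base)
  next
    case 2
    then have "E = (u / v) *\<^sub>R D"
      using arg_cong[OF assms(2), of "scaleR (1 / v)"] by simp
    then have "E \<in> span {D}"
      by (metis span_base span_scale singletonI)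
    then show ?thesis
      by (intro exI[of _ D] span_minimal) (auto simp: span_base)
  qed
  then obtain w where "(UNIV :: (real ^ 2) set) \<subseteq> span {w}"
    using assms(1) by auto
  then have "dim (UNIV :: (real ^ 2) set) \<le> card {w}"
    by (intro dim_le_card) auto
  then show False
    by simp
qed

lemma has_vector_derivative_edge_path_swap:
  assumes "(f \<circ> edge_path a b has_vector_derivative D) (at s)"
  shows "(f \<circ> edge_path b a has_vector_derivative - D) (at (1 - s))"
proof -
  have "((f \<circ> edge_path a b) \<circ> (\<lambda>t. 1 - t) has_vector_derivative (-1) *\<^sub>R D) (at (1 - s))"
    using assms by (intro vector_diff_chain_at) (auto intro!: derivative_eq_intros)
  moreover have "(f \<circ> edge_path a b) \<circ> (\<lambda>t. 1 - t) = f \<circ> edge_path b a"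
    by (auto simp: fun_eq_iff edge_path_swap[of b a])
  ultimately show ?thesis
    by simp
qed

text \<open>\<open>transversal_at\<close> supplies some parametrization of each edge, possibly the
  reverse of the one in use. Reversal only changes the sign of a tangent vector, which does not
  affect independence.\<close>

lemma transversal_at_derivatives:
  assumes "simple_graph G" "transversal_at G f x y" "x = edge_path a b s" "y = edge_path c d t"
    and "a \<noteq> b" "c \<noteq> d" "s \<in> {0..1}" "t \<in> {0..1}"
  shows "s \<in> {0<..<1} \<and> t \<in> {0<..<1} \<and>
    (\<exists>D E. (f \<circ> edge_path a b has_vector_derivative D) (at s) \<and>
      (f \<circ> edge_path c d has_vector_derivative E) (at t) \<and>
      (\<forall>u v. u *\<^sub>R D = v *\<^sub>R E \<longrightarrow> u = 0 \<and> v = 0))"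
proof -
  obtain a' b' c' d' s' t' D E where x: "{a', b'} \<in> snd G" "0 < s'" "s' < 1" "x = edge_path a' b' s'"
    and y: "{c', d'} \<in> snd G" "0 < t'" "t' < 1" "y = edge_path c' d' t'"
    and D: "(f \<circ> edge_path a' b' has_vector_derivative D) (at s')"
      "(f \<circ> edge_path c' d' has_vector_derivative E) (at t')" "span {D, E} = UNIV"
    using assms(2) unfolding transversal_at_def by blast
  have ne: "a' \<noteq> b'" "c' \<noteq> d'"
    using simple_graph_edgeD[OF assms(1)] x(1) y(1) by blast+
  have ind: "\<And>u v. u *\<^sub>R D = v *\<^sub>R E \<Longrightarrow> u = 0 \<and> v = 0"
    using spanning_pair_independent[OF D(3)] by blast
  have 1: "s \<in> {0<..<1} \<and> (\<exists>r\<in>{1,-1}. (f \<circ> edge_path a b has_vector_derivative r *\<^sub>R D) (at s))"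
    using edge_path_eq_iff[OF ne(1) assms(5), of s' s] x assms(3,7) D(1)
      has_vector_derivative_edge_path_swap[OF D(1)] by auto
  have 2: "t \<in> {0<..<1} \<and> (\<exists>r\<in>{1,-1}. (f \<circ> edge_path c d has_vector_derivative r *\<^sub>R E) (at t))"
    using edge_path_eq_iff[OF ne(2) assms(6), of t' t] y assms(4,8) D(2)
      has_vector_derivative_edge_path_swap[OF D(2)] by auto
  obtain q r where qr: "q \<in> {1, -1::real}" "r \<in> {1, -1::real}"
     "(f \<circ> edge_path a b has_vector_derivative q *\<^sub>R D) (at s)"
     "(f \<circ> edge_path c d has_vector_derivative r *\<^sub>R E) (at t)"
    using 1 2 by blast
  have "u = 0 \<and> v = 0" if "u *\<^sub>R (q *\<^sub>R D) = v *\<^sub>R (r *\<^sub>R E)" for u v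
    using ind[of "u * q" "v * r"] that qr(1,2) by auto
  then show ?thesis
    using 1 2 qr(3,4) by blast
qed

lemma transversal_at_sym:
  assumes "transversal_at G f x y"
  shows "transversal_at G f y x"
proof -
  obtain a b c d s t D E where
    "{a, b} \<in> snd G" "0 < s" "s < 1" "x = edge_path a b s"
    "{c, d} \<in> snd G" "0 < t" "t < 1" "y = edge_path c d t"
    "(f \<circ> edge_path a b has_vector_derivative D) (at s)"
    "(f \<circ> edge_path c d has_vector_derivative E) (at t)" "span {D, E} = UNIV"
    using assms unfolding transversal_at_def by blast
  then show ?thesis
    unfolding transversal_at_def
    by (intro exI[of _ c] exI[of _ d] exI[of _ a] exI[of _ b] exI[of _ t] exI[of _ s]
        exI[of _ E] exI[of _ D]) (simp add: insert_commute)
qed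

lemma disjoint_edge_paths_neq:
  assumes "a \<noteq> b" "{a, b} \<inter> {c, d} = {}"
  shows "edge_path a b s \<noteq> edge_path c d t"
proof
  assume eq: "edge_path a b s = edge_path c d t"
  show False
    using arg_cong[OF eq, of "\<lambda>z. z $ a"] arg_cong[OF eq, of "\<lambda>z. z $ b"] assms
    by (auto simp: edge_path_nth)
qed

text \<open>Exactly two points lie over \<open>p\<close>, so the two given points are those for
  which transversality is stated, in one order or the other.\<close>

lemma crossing_zero:
  assumes G: "simple_graph G" and f: "plane_generic_immersion G f"
    and e: "{a, b} \<in> snd G" "{c, d} \<in> snd G" and disj: "{a, b} \<inter> {c, d} = {}"
    and st: "s \<in> {0..1}" "t \<in> {0..1}" "f (edge_path a b s) = f (edge_path c d t)"
  defines "p \<equiv> f (edge_path a b s)"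
  shows "p \<in> multiple_points f (realization G)"
    "{z \<in> realization G. f z = p} = {edge_path a b s, edge_path c d t}"
    "transversal_at G f (edge_path a b s) (edge_path c d t)"
proof -
  let ?x = "edge_path a b s" and ?y = "edge_path c d t"
  have ne: "a \<noteq> b" "c \<noteq> d"
    using simple_graph_edgeD[OF G] e by blast+
  have R: "?x \<in> realization G" "?y \<in> realization G"
    using e st by (auto intro: edge_path_in_realization)
  have "?x \<noteq> ?y"
    by (rule disjoint_edge_paths_neq[OF ne(1) disj])
  then show p: "p \<in> multiple_points f (realization G)"
    using R st(3) unfolding multiple_points_def p_def by (intro CollectI bexI[of _ ?x] bexI[of _ ?y]) auto
  obtain x y where xy: "x \<noteq> y" "{z \<in> realization G. f z = p} = {x, y}" "transversal_at G f x y"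
    using multiple_point_cases[OF f p] .
  have "?x \<in> {x, y}" "?y \<in> {x, y}"
    unfolding xy(2)[symmetric] using R st(3) by (simp_all add: p_def)
  then have "?x = x \<and> ?y = y \<or> ?x = y \<and> ?y = x"
    using \<open>?x \<noteq> ?y\<close> by (elim insertE emptyE) simp_all
  then show "{z \<in> realization G. f z = p} = {?x, ?y}" "transversal_at G f ?x ?y"
    using xy transversal_at_sym[OF xy(3)] by auto
qed

text \<open>The value \<open>p\<close> determines its pair of preimages and, the edges being
  disjoint, which of them lies on which edge. For an edge paired with itself every crossing would be
  hit twice.\<close>

lemma crossings_bij_betw:
  assumes G: "simple_graph G" and f: "plane_generic_immersion G f"
    and e: "{a, b} \<in> snd G" "{c, d} \<in> snd G" and disj: "{a, b} \<inter> {c, d} = {}"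
  shows "bij_betw (\<lambda>(s, t). f (edge_path a b s))
     {(s, t). s \<in> {0..1} \<and> t \<in> {0..1} \<and> f (edge_path a b s) = f (edge_path c d t)}
     {p \<in> multiple_points f (realization G). crossing_edges G f p = {{a, b}, {c, d}}}"
    (is "bij_betw ?F ?Z ?P")
proof -
  have ne: "a \<noteq> b" "c \<noteq> d"
    using simple_graph_edgeD[OF G] e by blast+
  note zero = crossing_zero[OF G f e disj]
  have inter: "s \<in> {0<..<1} \<and> t \<in> {0<..<1}"
    if "s \<in> {0..1}" "t \<in> {0..1}" "f (edge_path a b s) = f (edge_path c d t)" for s t
    using transversal_at_derivatives[OF G zero(3)[OF that] refl refl ne that(1,2)] by blast
  show ?thesis
  proof (rule bij_betw_imageI)
    show "inj_on ?F ?Z"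
    proof (rule inj_onI, clarify)
      fix s t s' t'
      assume st: "s \<in> {0..1}" "t \<in> {0..1}" "f (edge_path a b s) = f (edge_path c d t)"
        and st': "s' \<in> {0..1}" "t' \<in> {0..1}" "f (edge_path a b s') = f (edge_path c d t')"
        and eq: "f (edge_path a b s) = f (edge_path a b s')"
      have pair: "{edge_path a b s, edge_path c d t} = {edge_path a b s', edge_path c d t'}"
        using zero(2)[OF st] zero(2)[OF st'] eq by simp
      have "edge_path a b s = edge_path a b s'" "edge_path c d t = edge_path c d t'"
        using pair disjoint_edge_paths_neq[OF ne(1) disj] by (metis doubleton_eq_iff)+
      then show "s = s' \<and> t = t'"
        using edge_path_eq_iff[OF ne(1) ne(1), of s s'] edge_path_eq_iff[OF ne(2) ne(2), of t t']
          inter[OF st] st' ne by auto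
    qed
    show "?F ` ?Z = ?P"
    proof (intro subset_antisym subsetI)
      fix p assume "p \<in> ?F ` ?Z"
      then obtain s t where st: "s \<in> {0..1}" "t \<in> {0..1}" "f (edge_path a b s) = f (edge_path c d t)"
        and p: "p = f (edge_path a b s)"
        by auto
      have "crossing_edges G f p = {{a, b}, {c, d}}"
        unfolding crossing_edges_def p zero(2)[OF st] using inter[OF st] ne by (simp add: support_edge_path)
      then show "p \<in> ?P"
        using zero(1)[OF st] p by simp
    next
      fix p assume p: "p \<in> ?P"
      then have "{a, b} \<in> support ` {z \<in> realization G. f z = p}" "{c, d} \<in> support ` {z \<in> realization G. f z = p}"
        by (auto simp: crossing_edges_def)
      then obtain x y where xy: "x \<in> realization G" "y \<in> realization G" "f x = p" "f y = p"
        "support x = {a, b}" "support y = {c, d}"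
        by auto
      \<comment> \<open>The support names the edge but not its direction; a reversed parametrization
        is repaired by \<open>1 - t\<close>.\<close>
      have path: "\<exists>t\<in>{0..1}. z = edge_path a b t"
        if z: "z \<in> realization G" "support z = {a, b}" "a \<noteq> b" for z and a b :: 'a
        using G z(1)
      proof (cases rule: realization_cases[consumes 2, case_names 1 2])
        case (1 v)
        then have "support z = {v}"
          by (auto simp: support_def axis_def)
        then show ?thesis
          using z by auto
      next
        case (2 a' b' t)
        then have "{a', b'} = {a, b}"
          using z support_edge_path by metis
        then have "a' = a \<and> b' = b \<or> a' = b \<and> b' = a"
          by (auto simp: doubleton_eq_iff)
        then show ?thesis
          using 2(3,4) edge_path_swap[of b a t] by (auto intro: bexI[of _ t] bexI[of _ "1 - t"])
      qed
      obtain s t where "s \<in> {0..1}" "x = edge_path a b s" "t \<in> {0..1}" "y = edge_path c d t"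
        using path[OF xy(1,5) ne(1)] path[OF xy(2,6) ne(2)] by blast
      then show "p \<in> ?F ` ?Z"
        using xy by (intro image_eqI[of _ _ "(s, t)"]) auto
    qed
  qed
qed

section \<open>The theorem\<close>

lemma hw_dist2_sym: "hw_dist2 x y \<longleftrightarrow> hw_dist2 y x"
  by (auto simp: hw_dist2_def)

lemma distinct_hw_edges: "distinct hw_edges"
  by code_simp

lemma set_hw_pairs: "set hw_pairs = {(x, y). x \<in> set hw_edges \<and> y \<in> set hw_edges \<and> hw_dist2 x y \<and> fst x < fst y}"
  by (auto simp: hw_pairs_def)

lemma distinct_hw_pairs: "distinct hw_pairs"
  by (simp add: hw_pairs_def distinct_product distinct_hw_edges)

lemma sum_list_map_eq_sum_count_int:
  fixes f :: "'a \<Rightarrow> int"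
  assumes "finite X" "set xs \<subseteq> X"
  shows "sum_list (map f xs) = (\<Sum>x\<in>X. of_nat (count_list xs x) * f x)"
  using assms(2)
proof (induction xs)
  case (Cons a xs)
  have "(\<Sum>x\<in>X. of_nat (count_list (a # xs) x) * f x) =
      (\<Sum>x\<in>X. of_nat (count_list xs x) * f x + (if x = a then f x else 0))"
    by (intro sum.cong) (auto simp: algebra_simps)
  also have "\<dots> = sum_list (map f xs) + f a"
    using Cons assms(1) by (simp add: sum.distrib)
  finally show ?case
    by simp
qed simp

lemma sum_dist2_ends_even:
  fixes N :: "int \<Rightarrow> int"
  assumes "y \<in> set hw_edges"
  shows "even (\<Sum>x | x \<in> set hw_edges \<and> hw_dist2 x y. N (fst x) + N (snd x))"
proof -
  have "(\<Sum>x | x \<in> set hw_edges \<and> hw_dist2 x y. N (fst x) + N (snd x)) =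
      sum_list (map (\<lambda>x. N (fst x) + N (snd x)) (filter (\<lambda>x. hw_dist2 x y) hw_edges))"
    by (subst sum_list_distinct_conv_sum_set) (simp_all add: distinct_hw_edges)
  also have "\<dots> = sum_list (map N (hw_dist2_ends y))"
  proof -
    have "(\<Sum>x\<leftarrow>xs. N (fst x) + N (snd x)) = sum_list (map N (concat (map (\<lambda>x. [fst x, snd x]) xs)))" for xs
      by (induction xs) simp_all
    then show ?thesis
      by (simp add: hw_dist2_ends_def)
  qed
  also have "\<dots> = (\<Sum>x\<in>set (hw_dist2_ends y). of_nat (count_list (hw_dist2_ends y) x) * N x)"
    by (rule sum_list_map_eq_sum_count_int) auto
  also have "\<dots> = (\<Sum>x\<in>set (hw_dist2_ends y). 2 * N x)"
    using hw_dist2_ends_twice assms by (intro sum.cong) (auto simp: all_twice_def)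
  finally show ?thesis
    by (simp flip: sum_distrib_left)
qed

text \<open>When each pair is taken in both orders, its four terms split into two for each order.
  For fixed \<open>y\<close> the inner sum then runs over the ends of the edges at distance 2 from
  \<open>y\<close>, each of which occurs twice.\<close>

lemma sum_hw_pairs_even:
  fixes n :: "int \<Rightarrow> int \<times> int \<Rightarrow> int"
  shows "even (\<Sum>(x, y)\<in>set hw_pairs. n (fst x) y + n (snd x) y + n (fst y) x + n (snd y) x)"
proof -
  let ?S = "set hw_pairs" and ?g = "\<lambda>x y. n (fst x) y + n (snd x) y"
  define T where "T = (SIGMA y:set hw_edges. {x. x \<in> set hw_edges \<and> hw_dist2 x y})"
  have "fst x \<noteq> fst y" if "hw_dist2 x y" for x y
    using that by (simp add: hw_dist2_def)
  note ne = this
  have T: "T = ?S \<union> prod.swap ` ?S"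
  proof (intro subset_antisym subsetI)
    fix t assume "t \<in> T"
    then obtain y x where t: "t = (y, x)" "y \<in> set hw_edges" "x \<in> set hw_edges" "hw_dist2 x y"
      by (auto simp: T_def)
    then have "(y, x) \<in> ?S \<or> (x, y) \<in> ?S"
      using ne[OF t(4)] hw_dist2_sym[of x y] by (auto simp: set_hw_pairs)
    then show "t \<in> ?S \<union> prod.swap ` ?S"
      using t(1) by force
  next
    fix t assume t: "t \<in> ?S \<union> prod.swap ` ?S"
    obtain y x where yx: "t = (y, x)"
      by (cases t)
    with t have "(y, x) \<in> ?S \<or> (x, y) \<in> ?S"
      by auto
    then show "t \<in> T"
      using hw_dist2_sym[of x y] yx by (auto simp: T_def set_hw_pairs)
  qed
  have "?S \<inter> prod.swap ` ?S = {}"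
    by (auto simp: set_hw_pairs)
  then have "(\<Sum>(y, x)\<in>T. ?g x y) = (\<Sum>(y, x)\<in>?S. ?g x y) + (\<Sum>(y, x)\<in>prod.swap ` ?S. ?g x y)"
    unfolding T by (intro sum.union_disjoint) auto
  also have "(\<Sum>(y, x)\<in>prod.swap ` ?S. ?g x y) = (\<Sum>(x, y)\<in>?S. ?g x y)"
    by (subst sum.reindex) (auto simp: case_prod_unfold)
  finally have "(\<Sum>(x, y)\<in>?S. n (fst x) y + n (snd x) y + n (fst y) x + n (snd y) x) = (\<Sum>(y, x)\<in>T. ?g x y)"
    by (simp add: case_prod_unfold sum.distrib algebra_simps)
  also have "\<dots> = (\<Sum>y\<in>set hw_edges. \<Sum>x | x \<in> set hw_edges \<and> hw_dist2 x y. ?g x y)"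
    unfolding T_def by (subst sum.Sigma) auto
  also have "even \<dots>"
    by (intro dvd_sum sum_dist2_ends_even)
  finally show ?thesis .
qed

text \<open>
  A logarithm of \<open>P y - P x\<close>, chosen so that those of opposite directions differ by exactly \<open>\<pi> \<i>\<close>.
\<close>

definition direction_log :: "(int \<Rightarrow> complex) \<Rightarrow> int \<Rightarrow> int \<Rightarrow> complex" where
  "direction_log P x y = (if x < y then Ln (P y - P x) else Ln (P x - P y) + of_real pi * \<i>)"

lemma exp_direction_log: "P x \<noteq> P y \<Longrightarrow> exp (direction_log P x y) = P y - P x"
  by (simp add: direction_log_def exp_add)

lemma direction_log_diff:
  "x \<noteq> y \<Longrightarrow> direction_log P y x - direction_log P x y = of_int (hw_sign x y) * (of_real pi * \<i>)"
  by (auto simp: direction_log_def hw_sign_def)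

text \<open>The preimages of a crossing are interior points of edges, and the support of a vertex is
  no edge. Hence winding numbers around images of vertices make sense for edges not ending
  there.\<close>

lemma vertex_image_unique:
  assumes G: "simple_graph G" and f: "plane_generic_immersion G f"
    and "v \<in> fst G" "z \<in> realization G" "f z = f (axis v 1)"
  shows "z = axis v 1"
proof (rule ccontr)
  assume "z \<noteq> axis v 1"
  have v: "axis v 1 \<in> realization G"
    using axis_in_realization_iff[OF G] assms(3) by blast
  then have mp: "f z \<in> multiple_points f (realization G)"
    using assms(4,5) \<open>z \<noteq> axis v 1\<close> unfolding multiple_points_def by auto
  obtain x y where "x \<noteq> y" and xy: "{w \<in> realization G. f w = f z} = {x, y}" "transversal_at G f x y"
    using multiple_point_cases[OF f mp] .
  have "axis v 1 \<in> {x, y}"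
    unfolding xy(1)[symmetric] using v assms(5) by simp
  then have "support (axis v 1) \<in> snd G"
    using transversal_at_support(1,2)[OF G xy(2)] by auto
  moreover have "support (axis v 1 :: real ^ 'a) = {v}"
    by (auto simp: support_def axis_def)
  ultimately show False
    using G by (auto simp: simple_graph_def)
qed

lemma dist2_crossings_odd:
  fixes f :: "real ^ (7 + 7) \<Rightarrow> real ^ 2"
  assumes f: "plane_generic_immersion heawood_graph f"
  shows "odd (card {p \<in> multiple_points f (realization heawood_graph). \<exists>x\<in>set hw_edges. \<exists>y\<in>set hw_edges.
    hw_dist2 x y \<and> crossing_edges heawood_graph f p = {hw_edge x, hw_edge y}})" (is "odd (card ?Q)")
proof -
  note G = simple_heawood_graph
  let ?R = "realization heawood_graph" and ?M = "multiple_points f (realization heawood_graph)"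
  define P where "P = (\<lambda>v. plane_to_complex (f (axis (hw_vertex v) 1)))"
  define ep where "ep = (\<lambda>e. edge_path (hw_vertex (fst e)) (hw_vertex (snd e)))"
  define g where "g = (\<lambda>e. plane_to_complex \<circ> f \<circ> ep e)"
  define l where "l = direction_log P"
  have edge: "{hw_vertex (fst e), hw_vertex (snd e)} \<in> snd heawood_graph" if "e \<in> set hw_edges" for e
    using that unfolding heawood_edges hw_edge_def by blast
  have ep_R: "ep e t \<in> ?R" if "e \<in> set hw_edges" "t \<in> {0..1}" for e t
    unfolding ep_def by (rule edge_path_in_realization[OF edge[OF that(1)] that(2)])
  have g_path: "path (g e)" if "e \<in> set hw_edges" for e
  proof -
    have "continuous_on ?R f"
      using f by (simp add: plane_generic_immersion_def plane_immersion_def)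
    moreover have "continuous_on {0..1} (ep e)"
      unfolding ep_def edge_path_def by (rule continuous_on_linepath)
    moreover have "ep e ` {0..1} \<subseteq> ?R"
      using ep_R[OF that] by blast
    ultimately have "continuous_on {0..1} (f \<circ> ep e)"
      by (meson continuous_on_compose continuous_on_subset)
    then have "continuous_on {0..1} (\<lambda>t. plane_to_complex ((f \<circ> ep e) t))"
      by (rule bounded_linear.continuous_on[OF bounded_linear_plane_to_complex])
    then show ?thesis
      by (simp add: path_def g_def comp_def)
  qed
  have g_ends: "g e 0 = P (fst e)" "g e 1 = P (snd e)" for e
    by (simp_all add: g_def P_def ep_def)
  have P_notin: "P v \<notin> path_image (g e)"
    if e: "e \<in> set hw_edges" and v: "v \<in> {0..13}" "v \<noteq> fst e" "v \<noteq> snd e" for e v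
  proof
    assume "P v \<in> path_image (g e)"
    then obtain t where t: "t \<in> {0..1}" "P v = g e t"
      by (auto simp: path_image_def)
    then have "f (ep e t) = f (axis (hw_vertex v) 1)"
      using inj_plane_to_complex by (auto simp: P_def g_def inj_eq)
    then have eq: "ep e t = axis (hw_vertex v) 1"
      using vertex_image_unique[OF G f _ ep_R[OF e t(1)]] by (simp add: fst_heawood_graph)
    have "hw_vertex v \<noteq> hw_vertex (fst e)" "hw_vertex v \<noteq> hw_vertex (snd e)"
      using inj_on_hw_vertex v hw_edges_range[OF e] by (auto dest: inj_onD)
    then show False
      using arg_cong[OF eq, of "\<lambda>z. z $ hw_vertex v"] by (simp add: ep_def edge_path_nth)
  qed
  have "\<exists>n. 2 * of_real pi * \<i> * winding_number (g e) (P v) =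
      l v (snd e) - l v (fst e) + 2 * of_real pi * \<i> * of_int n"
    if "e \<in> set hw_edges" "v \<in> {0..13}" "v \<noteq> fst e" "v \<noteq> snd e" for e v
  proof -
    have ni: "P v \<notin> path_image (g e)"
      by (rule P_notin[OF that])
    then have "P v \<noteq> g e 0" "P v \<noteq> g e 1"
      by (auto simp: path_image_def)
    then have "P v \<noteq> P (fst e)" "P v \<noteq> P (snd e)"
      by (simp_all only: g_ends not_False_eq_True)
    then show ?thesis
      by (intro winding_number_log_diff g_path that ni)
         (simp_all add: l_def exp_direction_log pathstart_def pathfinish_def g_ends)
  qed
  note ex_n = this
  \<comment> \<open>For \<open>v\<close> an end of \<open>e\<close> the choice is arbitrary;
    \<open>n v e\<close> is evaluated only for other vertices.\<close>
  define n where "n = (\<lambda>v e. SOME n :: int. 2 * of_real pi * \<i> * winding_number (g e) (P v) =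
      l v (snd e) - l v (fst e) + 2 * of_real pi * \<i> * of_int n)"
  have n: "2 * of_real pi * \<i> * winding_number (g e) (P v) =
      l v (snd e) - l v (fst e) + 2 * of_real pi * \<i> * of_int (n v e)"
    if "e \<in> set hw_edges" "v \<in> {0..13}" "v \<noteq> fst e" "v \<noteq> snd e" for e v
    unfolding n_def by (rule someI_ex[OF ex_n[OF that]])
  define C where "C = (\<lambda>(x, y). {p \<in> ?M. crossing_edges heawood_graph f p = {hw_edge x, hw_edge y}})"
  have parity: "even (card (C (x, y))) \<longleftrightarrow>
      even (n (fst x) y + n (snd x) y + n (fst y) x + n (snd y) x + hw_sign_sum (x, y))"
    if xy: "(x, y) \<in> set hw_pairs" for x y
  proof -
    have x: "x \<in> set hw_edges" and y: "y \<in> set hw_edges" and d: "hw_dist2 x y" and lt: "fst x < fst y"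
      using xy by (auto simp: set_hw_pairs)
    have rx: "fst x \<in> {0..13}" "snd x \<in> {0..13}" and ry: "fst y \<in> {0..13}" "snd y \<in> {0..13}"
      and fs: "fst x \<noteq> snd x" "fst x \<noteq> snd y" "snd x \<noteq> fst y" "fst y \<noteq> snd y"
      using hw_edges_range[OF x] hw_edges_range[OF y] by auto
    \<comment> \<open>A common v-vertex would be adjacent to both u-vertices, which
      \<open>hw_dist2\<close> forbids.\<close>
    have ss: "snd x \<noteq> snd y"
    proof
      assume eq: "snd x = snd y"
      have "(fst x, snd y) \<in> set hw_edges"
        unfolding eq[symmetric] using x by simp
      then have "snd y \<in> set (hw_nb (fst x))"
        using hw_nb_iff[OF rx(1) ry(2)] by blast
      then show False
        using d by (simp add: hw_dist2_def)
    qed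
    have ff: "fst x \<noteq> fst y"
      using lt by simp
    have disj: "{hw_vertex (fst x), hw_vertex (snd x)} \<inter> {hw_vertex (fst y), hw_vertex (snd y)} = {}"
      using inj_on_hw_vertex rx ry fs ff ss by (auto dest: inj_onD)
    note ex = edge[OF x] and ey = edge[OF y]
    have ne: "hw_vertex (fst x) \<noteq> hw_vertex (snd x)" "hw_vertex (fst y) \<noteq> hw_vertex (snd y)"
      using simple_graph_edgeD(1)[OF G] ex ey by blast+
    have Z: "{(s, t). s \<in> {0..1} \<and> t \<in> {0..1} \<and> g x s = g y t} =
        {(s, t). s \<in> {0..1} \<and> t \<in> {0..1} \<and> f (ep x s) = f (ep y t)}"
      using inj_plane_to_complex by (auto simp: g_def inj_eq)
    have bij: "bij_betw (\<lambda>(s, t). f (ep x s)) {(s, t). s \<in> {0..1} \<and> t \<in> {0..1} \<and> g x s = g y t} (C (x, y))"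
      unfolding Z C_def ep_def prod.case hw_edge_def
      by (rule crossings_bij_betw[OF G f ex ey disj])
    have finM: "finite ?M"
      using f by (simp add: plane_generic_immersion_def)
    then have finC: "finite (C (x, y))"
      by (simp add: C_def)
    have cr: "s \<in> {0<..<1} \<and> t \<in> {0<..<1} \<and>
       (\<exists>D E. (g x has_vector_derivative D) (at s) \<and> (g y has_vector_derivative E) (at t) \<and>
          (\<forall>u v. u *\<^sub>R D = v *\<^sub>R E \<longrightarrow> u = 0 \<and> v = 0))"
      if st: "s \<in> {0..1}" "t \<in> {0..1}" "g x s = g y t" for s t
    proof -
      have eq: "f (ep x s) = f (ep y t)"
        using st(3) inj_plane_to_complex by (simp add: g_def inj_eq)
      have "transversal_at heawood_graph f (ep x s) (ep y t)"
        using crossing_zero(3)[OF G f ex ey disj st(1,2)] eq by (simp add: ep_def)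
      then obtain D E where DE: "s \<in> {0<..<1}" "t \<in> {0<..<1}" "(f \<circ> ep x has_vector_derivative D) (at s)"
        "(f \<circ> ep y has_vector_derivative E) (at t)" "\<And>u v. u *\<^sub>R D = v *\<^sub>R E \<Longrightarrow> u = 0 \<and> v = 0"
        using transversal_at_derivatives[OF G _ refl refl ne st(1,2)] unfolding ep_def by blast
      interpret plane_to_complex: bounded_linear plane_to_complex
        by (rule bounded_linear_plane_to_complex)
      have "(g x has_vector_derivative plane_to_complex D) (at s)"
        "(g y has_vector_derivative plane_to_complex E) (at t)"
        using plane_to_complex.has_vector_derivative[OF DE(3)] plane_to_complex.has_vector_derivative[OF DE(4)]
        by (simp_all add: g_def comp_def)
      moreover have "u = 0 \<and> v = 0" if "u *\<^sub>R plane_to_complex D = v *\<^sub>R plane_to_complex E" for u v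
      proof -
        have "plane_to_complex (u *\<^sub>R D) = plane_to_complex (v *\<^sub>R E)"
          using that by (simp add: plane_to_complex.scaleR)
        then have "u *\<^sub>R D = v *\<^sub>R E"
          using inj_plane_to_complex by (simp add: inj_eq)
        then show ?thesis
          by (rule DE(5))
      qed
      ultimately show ?thesis
        using DE(1,2) by blast
    qed
    have "\<exists>k. 2 * k = hw_sign (snd x) (fst y) + hw_sign (snd y) (snd x) + hw_sign (fst x) (snd y) + hw_sign (fst y) (fst x) \<and>
      (even (card {(s, t). s \<in> {0..1} \<and> t \<in> {0..1} \<and> g x s = g y t}) \<longleftrightarrow>
       even (n (fst x) y + n (snd x) y + n (fst y) x + n (snd y) x + k))"
    \<comment> \<open>The vertices \<open>a\<close>, \<open>b\<close>, \<open>c\<close>,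
      \<open>d\<close> of the rule are the ends \<open>fst x\<close>, \<open>snd x\<close>,
      \<open>fst y\<close>, \<open>snd y\<close>.\<close>
    proof (rule crossing_parity_log[where l = l and h = hw_sign])
      show "path (g x)" "path (g y)"
        by (rule g_path[OF x], rule g_path[OF y])
      show "s \<in> {0<..<1} \<and> t \<in> {0<..<1} \<and>
         (\<exists>D E. (g x has_vector_derivative D) (at s) \<and> (g y has_vector_derivative E) (at t) \<and>
            (\<forall>u v. u *\<^sub>R D = v *\<^sub>R E \<longrightarrow> u = 0 \<and> v = 0))"
        if "s \<in> {0..1}" "t \<in> {0..1}" "g x s = g y t" for s t
        by (rule cr[OF that])
      show "fst x \<noteq> fst y" "fst x \<noteq> snd y" "snd x \<noteq> fst y" "snd x \<noteq> snd y"
        by (rule ff fs ss)+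
      show "finite {(s, t). s \<in> {0..1} \<and> t \<in> {0..1} \<and> g x s = g y t}"
        using bij_betw_finite[OF bij] finC by blast
      show "l v u - l u v = of_int (hw_sign u v) * (of_real pi * \<i>)" if "u \<noteq> v" for u v
        unfolding l_def by (rule direction_log_diff[OF that])
      show "2 * of_real pi * \<i> * winding_number (g x) (g y 0) =
          l (fst y) (snd x) - l (fst y) (fst x) + 2 * of_real pi * \<i> * of_int (n (fst y) x)"
        unfolding g_ends by (rule n[OF x ry(1) ff[symmetric] fs(3)[symmetric]])
      show "2 * of_real pi * \<i> * winding_number (g x) (g y 1) =
          l (snd y) (snd x) - l (snd y) (fst x) + 2 * of_real pi * \<i> * of_int (n (snd y) x)"
        unfolding g_ends by (rule n[OF x ry(2) fs(2)[symmetric] ss[symmetric]])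
      show "2 * of_real pi * \<i> * winding_number (g y) (g x 0) =
          l (fst x) (snd y) - l (fst x) (fst y) + 2 * of_real pi * \<i> * of_int (n (fst x) y)"
        unfolding g_ends by (rule n[OF y rx(1) ff fs(2)])
      show "2 * of_real pi * \<i> * winding_number (g y) (g x 1) =
          l (snd x) (snd y) - l (snd x) (fst y) + 2 * of_real pi * \<i> * of_int (n (snd x) y)"
        unfolding g_ends by (rule n[OF y rx(2) fs(3) ss])
    qed
    then obtain k where k: "2 * k = hw_sign (snd x) (fst y) + hw_sign (snd y) (snd x) + hw_sign (fst x) (snd y) + hw_sign (fst y) (fst x)"
      and card: "even (card {(s, t). s \<in> {0..1} \<and> t \<in> {0..1} \<and> g x s = g y t}) \<longleftrightarrow>
       even (n (fst x) y + n (snd x) y + n (fst y) x + n (snd y) x + k)"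
      by (elim exE conjE)
    have "hw_sign_sum (x, y) = k"
      unfolding hw_sign_sum_def case_prod_unfold fst_conv snd_conv k[symmetric] by simp
    then show ?thesis
      using card unfolding bij_betw_same_card[OF bij] by (simp only:)
  qed
  have fin: "finite (C t)" for t
    using f by (auto simp: C_def plane_generic_immersion_def split: prod.split)
  have Q: "?Q = (\<Union>t\<in>set hw_pairs. C t)"
  proof (intro subset_antisym subsetI)
    fix p assume "p \<in> ?Q"
    then obtain x y where xy: "p \<in> ?M" "x \<in> set hw_edges" "y \<in> set hw_edges" "hw_dist2 x y"
      "crossing_edges heawood_graph f p = {hw_edge x, hw_edge y}"
      by blast
    then have "fst x < fst y \<or> fst y < fst x"
      by (auto simp: hw_dist2_def)
    then have "(x, y) \<in> set hw_pairs \<or> (y, x) \<in> set hw_pairs"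
      using xy hw_dist2_sym by (auto simp: set_hw_pairs)
    then show "p \<in> (\<Union>t\<in>set hw_pairs. C t)"
      using xy(1,5) unfolding C_def by (auto simp: insert_commute)
  qed (auto simp: C_def set_hw_pairs)
  have disjC: "C t \<inter> C t' = {}" if "t \<in> set hw_pairs" "t' \<in> set hw_pairs" "t \<noteq> t'" for t t'
  proof (rule ccontr)
    assume "C t \<inter> C t' \<noteq> {}"
    then have "{hw_edge (fst t), hw_edge (snd t)} = {hw_edge (fst t'), hw_edge (snd t')}"
      by (auto simp: C_def case_prod_unfold)
    moreover have e: "fst t \<in> set hw_edges" "snd t \<in> set hw_edges" "fst (fst t) < fst (snd t)"
      "fst t' \<in> set hw_edges" "snd t' \<in> set hw_edges" "fst (fst t') < fst (snd t')"
      using that by (auto simp: set_hw_pairs)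
    \<comment> \<open>The swapped alternative contradicts the order of the u-vertices in
      \<open>hw_pairs\<close>.\<close>
    ultimately have "fst t = fst t' \<and> snd t = snd t' \<or> fst t = snd t' \<and> snd t = fst t'"
      using inj_on_hw_edge by (auto simp: doubleton_eq_iff dest: inj_onD)
    then show False
      using e that(3) by (auto simp: prod_eq_iff)
  qed
  have "int (card ?Q) = (\<Sum>t\<in>set hw_pairs. int (card (C t)))"
    unfolding Q using disjC fin by (subst card_UN_disjoint) auto
  then have "even (int (card ?Q)) \<longleftrightarrow> even (\<Sum>t\<in>set hw_pairs. int (card (C t)))"
    by simp
  \<comment> \<open>The sums agree in parity term by term, so they have the same set of odd
    terms.\<close>
  also have "\<dots> \<longleftrightarrow> even (\<Sum>(x, y)\<in>set hw_pairs. n (fst x) y + n (snd x) y + n (fst y) x + n (snd y) x + hw_sign_sum (x, y))"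
    using parity by (auto simp: even_sum_iff intro!: arg_cong[of _ _ even] arg_cong[of _ _ card])
  also have "(\<Sum>(x, y)\<in>set hw_pairs. n (fst x) y + n (snd x) y + n (fst y) x + n (snd y) x + hw_sign_sum (x, y)) =
      (\<Sum>(x, y)\<in>set hw_pairs. n (fst x) y + n (snd x) y + n (fst y) x + n (snd y) x) + (\<Sum>t\<in>set hw_pairs. hw_sign_sum t)"
    by (simp add: case_prod_unfold sum.distrib)
  also have "(\<Sum>t\<in>set hw_pairs. hw_sign_sum t) = sum_list (map hw_sign_sum hw_pairs)"
    by (simp add: sum_list_distinct_conv_sum_set distinct_hw_pairs)
  finally show ?thesis
    using sum_hw_pairs_even[of n] hw_sign_sum_odd by simp
qed

theorem theorem1p10:
  fixes f :: "real ^ (7 + 7) \<Rightarrow> real ^ 2"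
  assumes "plane_generic_immersion heawood_graph f"
  shows "[(\<Sum>\<gamma>\<in>cycles 6 heawood_graph. crossing_number f \<gamma>) = 1] (mod 2)
       \<and> [(\<Sum>\<gamma>\<in>cycles 8 heawood_graph. crossing_number f \<gamma>) = 1] (mod 2)
       \<and> [(\<Sum>\<gamma>\<in>cycles 10 heawood_graph. crossing_number f \<gamma>) = 1] (mod 2)
       \<and> [(\<Sum>\<gamma>\<in>cycles 12 heawood_graph. crossing_number f \<gamma>) = 0] (mod 4)
       \<and> [(\<Sum>\<gamma>\<in>cycles 14 heawood_graph. crossing_number f \<gamma>) = 0] (mod 2)"
proof -
  let ?G = heawood_graph
  let ?M = "multiple_points f (realization ?G)"
  define c where "c = (\<lambda>k p. card {\<gamma> \<in> cycles k ?G. crossing_edges ?G f p \<subseteq> snd \<gamma>})"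
  define Q where "Q = (\<lambda>p. \<exists>x\<in>set hw_edges. \<exists>y\<in>set hw_edges.
    hw_dist2 x y \<and> crossing_edges ?G f p = {hw_edge x, hw_edge y})"
  have sum: "(\<Sum>\<gamma>\<in>cycles k ?G. crossing_number f \<gamma>) = (\<Sum>p\<in>?M. c k p)" for k
    unfolding c_def by (rule sum_crossing_number[OF simple_heawood_graph assms])
  have fin: "finite ?M"
    using assms by (simp add: plane_generic_immersion_def)
  have Q_odd: "odd (card {p \<in> ?M. Q p})"
    unfolding Q_def by (rule dist2_crossings_odd[OF assms])
  \<comment> \<open>All pairs of edges are covered, equal and adjacent ones included: nothing is
    known about the number of such crossings, so their coefficients must already have the right
    residue.\<close>
  have counts: "(odd (c 6 p) \<longleftrightarrow> Q p) \<and> (odd (c 8 p) \<longleftrightarrow> Q p) \<and> (odd (c 10 p) \<longleftrightarrow> Q p) \<and> 4 dvd c 12 p \<and> 2 dvd c 14 p"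
    if "p \<in> ?M" for p
  proof -
    obtain e e' where "crossing_edges ?G f p = {e, e'}" "e \<in> snd ?G" "e' \<in> snd ?G"
      using crossing_edges_cases[OF simple_heawood_graph assms \<open>p \<in> ?M\<close>] .
    then obtain x y where xy: "x \<in> set hw_edges" "y \<in> set hw_edges"
      "crossing_edges ?G f p = {hw_edge x, hw_edge y}"
      by (auto simp: heawood_edges)
    have "Q p \<longleftrightarrow> hw_dist2 x y"
    proof
      assume "Q p"
      then obtain x' y' where xy': "x' \<in> set hw_edges" "y' \<in> set hw_edges" "hw_dist2 x' y'"
        "{hw_edge x, hw_edge y} = {hw_edge x', hw_edge y'}"
        using xy(3) by (auto simp: Q_def)
      then have "x = x' \<and> y = y' \<or> x = y' \<and> y = x'"
        using inj_on_hw_edge xy(1,2) by (auto simp: doubleton_eq_iff dest: inj_onD)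
      then show "hw_dist2 x y"
        using xy'(3) hw_dist2_sym[of x y] by auto
    qed (use xy in \<open>auto simp: Q_def\<close>)
    moreover have "c k p = path_count x (of_length k (hw_paths x)) y" if "3 \<le> k" "k \<le> 14" for k
      unfolding c_def xy(3) by (rule card_cycles_through_edges[OF xy(1,2) that])
    moreover have "hw_counts_ok x (hw_paths x)"
      using hw_parities[OF xy(1)] by (simp add: hw_parities_def)
    ultimately show ?thesis
      using xy(2) by (simp add: hw_counts_ok_def odd_at_dist2_def count_dvd_def dvd_eq_mod_eq_0)
  qed
  have odd: "[(\<Sum>p\<in>?M. c k p) = 1] (mod 2)" if "k \<in> {6, 8, 10}" for k
  proof -
    have "{p \<in> ?M. odd (c k p)} = {p \<in> ?M. Q p}"
      using counts that by auto
    then have "odd (\<Sum>p\<in>?M. c k p)"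
      using Q_odd by (simp add: even_sum_iff[OF fin])
    then show ?thesis
      by (simp add: cong_def odd_iff_mod_2_eq_one)
  qed
  have "4 dvd (\<Sum>p\<in>?M. c 12 p)" "2 dvd (\<Sum>p\<in>?M. c 14 p)"
    using counts by (auto intro!: dvd_sum)
  then show ?thesis
    unfolding sum using odd by (simp add: cong_0_iff)
qed

end
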